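(* Let $T_A$ be the Shiryaev changepoint detection procedure. Let $r\ge 1$. Let the prior distribution of the change point $\nu$ satisfy, for some $0\le\mu<\infty$, $$\lim_{n\to\infty}\frac{|\log(1-\Pi_n)|}{n}=\mu,$$ and, in the case $\mu=0$, assume in addition that $\sum_{k=0}^\infty \pi_k|\log\pi_k|^r<\infty$. Assume that for some number $0<I<\infty$ $$\lim_{M\to\infty}\mathsf{P}_k\Big(\frac1M\max_{1\le n\le M}\lambda_{k+n}^k\ge(1+\varepsilon)I\Big)=0\quad\text{for all }\varepsilon>0\text{ and all }k\in\mathbb{Z}_+,$$ and $$\sum_{k=0}^\infty\pi_k\,\Upsilon_{k,r}(\varepsilon)<\infty\quad\text{for all }\varepsilon>0,\qquad\text{where } \Upsilon_{k,r}(\varepsilon)=\sum_{n=1}^\infty n^{r-1}\mathsf{P}_k\Big(\frac1n\lambda_{k+n}^k<I-\varepsilon\Big).$$ (i) Then for all $0<m\le r$ $$\lim_{A\to\infty}\frac{\mathsf{E}^\pi[(T_A-\nu)^m\mid T_A>\nu]}{(\log A)^m}=\frac1{(I+\mu)^m}.$$ (ii) If $A=A_\alpha=(1-\alpha)/\alpha$, where $0<\alpha<1-q$, then $T_{A_\alpha}\in\mathbb{C}_\alpha$ and it is asymptotically optimal as $\alpha\to0$ in the class $\mathbb{C}_\alpha$, minimizing moments of the detection delay up to order $r$, i.e., for all $0<m\le r$, $$\lim_{\alpha\to0}\frac{\inf_{T\in\mathbb{C}_\alpha}\mathsf{E}^\pi[(T-\nu)^m\mid T>\nu]}{\mathsf{E}^\pi[(T_{A_\alpha}-\nu)^m\mid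 T_{A_\alpha}>\nu]}=1.$$ Also, the following first-order asymptotic approximations hold: $$\inf_{T\in\mathbb{C}_\alpha}\mathsf{E}^\pi[(T-\nu)^m\mid T>\nu]\sim\mathsf{E}^\pi[(T_{A_\alpha}-\nu)^m\mid T_{A_\alpha}>\nu]\sim\Big(\frac{|\log\alpha|}{I+\mu}\Big)^m\quad\text{as }\alpha\to0.$$ This assertion also holds if $A=A_\alpha$ is selected so that $\mathsf{PFA}(T_{A_\alpha})\le\alpha$ and $\log A_\alpha\sim|\log\alpha|$ as $\alpha\to0$.
   Context: Model. $\mathbb{Z}_+=\{0,1,2,\dots\}$. Observations $X_1,X_2,\dots$ are random variables on a measurable space $(\Omega,\mathscr{F})$; $\mathbf{X}^n=(X_1,\dots,X_n)$, $\mathscr{F}_n=\sigma(\mathbf{X}^n)$. $\mathsf{P}_\infty$ (no change) and $\mathsf{P}_0$ are probability measures whose restrictions to $\mathscr{F}_n$ are mutually absolutely continuous for every $n\ge1$, with conditional densities $p_j(X_i|\mathbf{X}^{i-1})$, $j=\infty,0$, with respect to a non-degenerate $\sigma$-finite measure (these may depend on $i$, and $p_0(X_i|\mathbf{X}^{i-1})$ for $i>\nu$ may also depend on the change point $\nu$; this dependence is suppressed in the notation). No independence or identical distribution is assumed. For $k\in\mathbb{Z}_+$, $\mathsf{P}_k$ (expectation $\mathsf{E}_k$) is the measure when the change point is $\nu=k$ ($k$ is the index of the last pre-change observation), under which $\mathbf{X}^n$ has density $\prod_{i=1}^{k}p_\infty(X_i|\mathbf{X}^{i-1})\prod_{i=k+1}^n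 p_0(X_i|\mathbf{X}^{i-1})$ for $n>k$ and $\prod_{i=1}^n p_\infty(X_i|\mathbf{X}^{i-1})$ for $n\le k$. Prior. The change point $\nu$ is an integer-valued random variable independent of the observations, with prior $\Pi_n=\mathsf{P}(\nu\le n)$, $\pi_k=\mathsf{P}(\nu=k)$ for $k\in\mathbb{Z}_+$, and $q=\mathsf{P}(\nu<0)\in[0,1)$ (the prior on negative integers matters only through $q$). Terms $\pi_k|\log\pi_k|^r$ with $\pi_k=0$ are $0$. Log-likelihood ratios. $\mathcal{L}_i=p_0(X_i|\mathbf{X}^{i-1})/p_\infty(X_i|\mathbf{X}^{i-1})$, $Z_i=\log\mathcal{L}_i$, $\lambda_{k+n}^k=\sum_{i=k+1}^{k+n}Z_i$ for $n\ge1$. Detection procedures. A detection procedure is a stopping time $T\ge1$ (possibly infinite) with respect to $\{\mathscr{F}_n\}$. Its weighted probability of false alarm is $\mathsf{PFA}(T)=\sum_{k=1}^\infty\pi_k\mathsf{P}_\infty(T\le k)$, and $\mathbb{C}_\alpha=\{T:\mathsf{PFA}(T)\le\alpha\}$ for $0<\alpha<1$. The moments of the detection delay are, by definition, $$\mathsf{E}^\pi[(T-\nu)^m\mid T>\nu]=\frac{\sum_{k=0}^\infty\pi_k\,\mathsf{E}_k[(T-k)^m\mid T>k]\,\mathsf{P}_\infty(T>k)}{1-\mathsf{PFA}(T)}=\frac{\sum_{k=0}^\infty\pi_k\,\mathsf{E}_k[((T-k)^+)^m]}{1-\mathsf{PFA}(T)}.$$ Shiryaev procedure. $T_A=\inf\{n\ge1:\Lambda_n\ge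 A\}$, $A>q/(1-q)$, where $\Lambda_n=\frac1{\mathsf{P}(\nu\ge n)}\big(q\prod_{i=1}^n\mathcal{L}_i+\sum_{k=0}^{n-1}\pi_k\prod_{i=k+1}^n\mathcal{L}_i\big)$. $f\sim g$ means that the ratio $f/g$ tends to $1$.
   Formalization: The limit 1/(I+μ)^m in (i) and the approximation (|log α|/(I+μ))^m in (ii) are multiplied by 1−q: with the given definition of the delay moments the weights π_k, k≥0, sum to 1−q while 1−PFA→1, so the printed constants fail for every q>0; for q=0 nothing changes. *)

theory Defs
  imports "HOL-Probability.Probability"
begin

section \<open>Observations and their laws\<close>

definition obs_vec :: "(nat \<Rightarrow> 'a \<Rightarrow> 'b) \<Rightarrow> nat set \<Rightarrow> 'a \<Rightarrow> nat \<Rightarrow> 'b" where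
  "obs_vec X J \<omega> = (\<lambda>j\<in>J. X j \<omega>)"

text \<open>
  The filtration \<open>\<F>\<^sub>n = \<sigma>(X\<^sub>1, \<dots>, X\<^sub>n)\<close>. It is indexed by \<open>enat\<close> only because stopping times may
  be infinite and \<^const>\<open>stopping_time\<close> uses one index type for both; the value at \<open>\<infinity>\<close>,
  which is \<open>\<sigma>(X\<^sub>1, X\<^sub>2, \<dots>)\<close>, imposes no condition on a stopping time.
\<close>

definition obs_filtration ::
    "'a set \<Rightarrow> 'b measure \<Rightarrow> (nat \<Rightarrow> 'a \<Rightarrow> 'b) \<Rightarrow> enat \<Rightarrow> 'a measure" where
  "obs_filtration \<Omega> S X t =
     vimage_algebra \<Omega> (obs_vec X {j. 1 \<le> j \<and> enat j \<le> t})
       (PiM {j. 1 \<le> j \<and> enat j \<le> t} (\<lambda>_. S))"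

definition mutually_abs_cont_on :: "'a measure \<Rightarrow> 'a measure \<Rightarrow> 'a measure \<Rightarrow> bool" where
  "mutually_abs_cont_on F P Q \<longleftrightarrow>
     absolutely_continuous (restr_to_subalg P F) (restr_to_subalg Q F) \<and>
     absolutely_continuous (restr_to_subalg Q F) (restr_to_subalg P F)"

text \<open>
  \<open>pinf i h y\<close> is the pre-change conditional density of \<open>X\<^sub>i\<close> at \<open>y\<close> given \<open>(X\<^sub>1, \<dots>, X\<^sub>i\<^sub>-\<^sub>1) = h\<close>, and
  \<open>p0 k i h y\<close>, for \<open>i > k\<close>, is the post-change one when the change point is \<open>k\<close> (values for \<open>i \<le> k\<close>
  are never used). Since the joint densities below are prescribed for every \<open>n\<close>, these functions
  automatically integrate to 1 for almost every history.

  As the post-change densities may depend on \<open>k\<close>, mutual absolute continuity with the no-change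
  measure is required of each \<open>P k\<close>; if they do not depend on \<open>k\<close>, the case \<open>k = 0\<close> implies all others.
  It makes the likelihood ratios a.s. positive and finite, so that the conventions
  \<open>x / 0 = 0\<close> and \<open>ln 0 = 0\<close> only matter on null sets.
\<close>

locale changepoint_model =
  fixes S :: "'b measure"
    and X :: "nat \<Rightarrow> 'a \<Rightarrow> 'b"
    and Pinf :: "'a measure"
    and P :: "nat \<Rightarrow> 'a measure"
    and pinf :: "nat \<Rightarrow> (nat \<Rightarrow> 'b) \<Rightarrow> 'b \<Rightarrow> real"
    and p0 :: "nat \<Rightarrow> nat \<Rightarrow> (nat \<Rightarrow> 'b) \<Rightarrow> 'b \<Rightarrow> real"
  assumes sigma_finite_S: "sigma_finite_measure S"
    and nondegenerate_S: "emeasure S (space S) \<noteq> 0"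
    and prob_space_Pinf: "prob_space Pinf"
    and prob_space_P: "\<And>k. prob_space (P k)"
    and sets_P: "\<And>k. sets (P k) = sets Pinf"
    and measurable_X: "\<And>i. 1 \<le> i \<Longrightarrow> X i \<in> measurable Pinf S"
    and pinf_nonneg: "\<And>i h y. 1 \<le> i \<Longrightarrow> 0 \<le> pinf i h y"
    and p0_nonneg: "\<And>k i h y. k < i \<Longrightarrow> 0 \<le> p0 k i h y"
    and measurable_pinf: "\<And>i. 1 \<le> i \<Longrightarrow>
          (\<lambda>(h, y). pinf i h y) \<in> borel_measurable (PiM {1..<i} (\<lambda>_. S) \<Otimes>\<^sub>M S)"
    and measurable_p0: "\<And>k i. k < i \<Longrightarrow>
          (\<lambda>(h, y). p0 k i h y) \<in> borel_measurable (PiM {1..<i} (\<lambda>_. S) \<Otimes>\<^sub>M S)"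
    and density_Pinf: "\<And>n. 1 \<le> n \<Longrightarrow>
          distributed Pinf (PiM {1..n} (\<lambda>_. S)) (obs_vec X {1..n})
            (\<lambda>x. ennreal (\<Prod>i\<in>{1..n}. pinf i (restrict x {1..<i}) (x i)))"
    and density_P: "\<And>k n. 1 \<le> n \<Longrightarrow>
          distributed (P k) (PiM {1..n} (\<lambda>_. S)) (obs_vec X {1..n})
            (\<lambda>x. ennreal (\<Prod>i\<in>{1..n}. if i \<le> k then pinf i (restrict x {1..<i}) (x i)
                                         else p0 k i (restrict x {1..<i}) (x i)))"
    and mutually_abs_cont: "\<And>k n. 1 \<le> n \<Longrightarrow>
          mutually_abs_cont_on (obs_filtration (space Pinf) S X (enat n)) Pinf (P k)"

text \<open>
  \<open>\<L>\<^sub>i\<close> and \<open>\<lambda>\<^bsub>k+n\<^esub>\<^bsup>k\<^esup>\<close>; the extra index \<open>k\<close> of the former is the change point on which the post-change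
  density may depend.
\<close>

definition lik_ratio ::
    "(nat \<Rightarrow> (nat \<Rightarrow> 'b) \<Rightarrow> 'b \<Rightarrow> real) \<Rightarrow> (nat \<Rightarrow> nat \<Rightarrow> (nat \<Rightarrow> 'b) \<Rightarrow> 'b \<Rightarrow> real) \<Rightarrow>
     (nat \<Rightarrow> 'a \<Rightarrow> 'b) \<Rightarrow> nat \<Rightarrow> nat \<Rightarrow> 'a \<Rightarrow> real" where
  "lik_ratio pinf p0 X k i \<omega> =
     p0 k i (obs_vec X {1..<i} \<omega>) (X i \<omega>) / pinf i (obs_vec X {1..<i} \<omega>) (X i \<omega>)"

definition llr :: "(nat \<Rightarrow> nat \<Rightarrow> 'a \<Rightarrow> real) \<Rightarrow> nat \<Rightarrow> nat \<Rightarrow> 'a \<Rightarrow> real" where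
  "llr L k n \<omega> = (\<Sum>i\<in>{k+1..k+n}. ln (L k i \<omega>))"

definition Upsilon ::
    "(nat \<Rightarrow> 'a measure) \<Rightarrow> (nat \<Rightarrow> nat \<Rightarrow> 'a \<Rightarrow> real) \<Rightarrow> real \<Rightarrow> nat \<Rightarrow> real \<Rightarrow> real \<Rightarrow> ennreal" where
  "Upsilon P L I k r \<epsilon> =
     (\<Sum>j. let n = Suc j in
        ennreal (real n powr (r - 1) *
          measure (P k) {\<omega> \<in> space (P k). llr L k n \<omega> / real n < I - \<epsilon>}))"


section \<open>Prior distribution of the change point\<close>

text \<open>The prior is the law of the integer-valued change point \<open>\<nu>\<close>.\<close>

definition prior_mass :: "int pmf \<Rightarrow> nat \<Rightarrow> real" where
  "prior_mass prior k = pmf prior (int k)"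

definition prior_cdf :: "int pmf \<Rightarrow> nat \<Rightarrow> real" where
  "prior_cdf prior n = measure_pmf.prob prior {..int n}"

definition prior_neg :: "int pmf \<Rightarrow> real" where
  "prior_neg prior = measure_pmf.prob prior {..<0}"


section \<open>Detection procedures\<close>

definition detection_procedure ::
    "'a set \<Rightarrow> 'b measure \<Rightarrow> (nat \<Rightarrow> 'a \<Rightarrow> 'b) \<Rightarrow> ('a \<Rightarrow> enat) \<Rightarrow> bool" where
  "detection_procedure \<Omega> S X T \<longleftrightarrow>
     stopping_time (obs_filtration \<Omega> S X) T \<and> (\<forall>\<omega>\<in>\<Omega>. 1 \<le> T \<omega>)"

definition PFA :: "int pmf \<Rightarrow> 'a measure \<Rightarrow> ('a \<Rightarrow> enat) \<Rightarrow> real" where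
  "PFA prior Pinf T =
     (\<Sum>j. let k = Suc j in
        prior_mass prior k * measure Pinf {\<omega> \<in> space Pinf. T \<omega> \<le> enat k})"

definition PFA_class ::
    "int pmf \<Rightarrow> 'b measure \<Rightarrow> (nat \<Rightarrow> 'a \<Rightarrow> 'b) \<Rightarrow> 'a measure \<Rightarrow> real \<Rightarrow> ('a \<Rightarrow> enat) set" where
  "PFA_class prior S X Pinf \<alpha> =
     {T. detection_procedure (space Pinf) S X T \<and> PFA prior Pinf T \<le> \<alpha>}"

definition enat_powr :: "enat \<Rightarrow> real \<Rightarrow> ennreal" where
  "enat_powr d m = (case d of enat j \<Rightarrow> ennreal (real j powr m) | \<infinity> \<Rightarrow> \<infinity>)"

text \<open>
  The moment \<open>E\<^sup>\<pi>[(T - \<nu>)\<^sup>m | T > \<nu>] = (\<Sum>k\<ge>0. \<pi>\<^sub>k E\<^sub>k[((T - k)\<^sup>+)\<^sup>m]) / (1 - PFA(T))\<close>, for \<open>m > 0\<close>. It may be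
  infinite. Subtraction on \<open>enat\<close> is truncated, so \<open>T \<omega> - enat k\<close> is the positive part.

  Only \<open>k \<ge> 0\<close> contributes to the numerator, so the weights there have total mass
  \<open>1 - q\<close> with \<open>q = P(\<nu> < 0)\<close>, while the denominator tends to 1 as the false alarm probability tends
  to 0. Hence first-order approximations of this quantity carry the factor \<open>1 - q\<close>, which
  disappears for \<open>q = 0\<close>.
\<close>

definition delay_moment ::
    "int pmf \<Rightarrow> 'a measure \<Rightarrow> (nat \<Rightarrow> 'a measure) \<Rightarrow> real \<Rightarrow> ('a \<Rightarrow> enat) \<Rightarrow> ennreal" where
  "delay_moment prior Pinf P m T =
     (\<Sum>k. ennreal (prior_mass prior k) * (\<integral>\<^sup>+\<omega>. enat_powr (T \<omega> - enat k) m \<partial>(P k)))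
       / ennreal (1 - PFA prior Pinf T)"

text \<open>
  The Shiryaev statistic \<open>\<Lambda>\<^sub>n\<close> and procedure \<open>T\<^sub>A\<close>. A change at a negative time is treated as a change at 0,
  hence the likelihood ratios with change point 0 in the \<open>q\<close>-term. The infimum of the empty
  set is \<open>\<infinity>\<close>.
\<close>

definition shiryaev_stat :: "int pmf \<Rightarrow> (nat \<Rightarrow> nat \<Rightarrow> 'a \<Rightarrow> real) \<Rightarrow> nat \<Rightarrow> 'a \<Rightarrow> real" where
  "shiryaev_stat prior L n \<omega> =
     (prior_neg prior * (\<Prod>i\<in>{1..n}. L 0 i \<omega>)
        + (\<Sum>k<n. prior_mass prior k * (\<Prod>i\<in>{k+1..n}. L k i \<omega>)))
     / measure_pmf.prob prior {int n..}"

definition shiryaev :: "int pmf \<Rightarrow> (nat \<Rightarrow> nat \<Rightarrow> 'a \<Rightarrow> real) \<Rightarrow> real \<Rightarrow> 'a \<Rightarrow> enat" where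
  "shiryaev prior L A \<omega> = (INF n\<in>{n. 1 \<le> n \<and> A \<le> shiryaev_stat prior L n \<omega>}. enat n)"

definition ratio_equiv :: "('c \<Rightarrow> ennreal) \<Rightarrow> 'c filter \<Rightarrow> ('c \<Rightarrow> ennreal) \<Rightarrow> bool" where
  "ratio_equiv f F g \<longleftrightarrow> ((\<lambda>x. f x / g x) \<longlongrightarrow> 1) F"

end

theory Submission
  imports Defs "HOL-Real_Asymp.Real_Asymp"
begin

text \<open>
  Write \<open>w n = P(\<nu> \<ge> n)\<close>, which decays at the exponential rate \<open>\<mu>\<close>. Splitting the false alarm event
  according to the value of the stopping time gives \<open>PFA (T\<^sub>A) \<le> 1 / (1 + A)\<close>.

  Lower bound: every \<open>T\<close> with \<open>PFA T \<le> \<alpha>\<close> has \<open>Pinf (T \<le> n) \<le> \<alpha> / w n\<close>. Let \<open>M = b \<bar>ln \<alpha>\<bar>\<close> with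
  \<open>b < 1 / (I + \<mu>)\<close>. A change of measure costs a factor \<open>exp ((1 + \<epsilon>) I M)\<close> off an event whose probability
  tends to 0, so \<open>P k (T \<le> k + M)\<close> is at most about \<open>\<alpha> exp (((1 + \<epsilon>) I + \<mu> + \<epsilon>) M)\<close>, which tends to 0
  uniformly in \<open>T\<close>; Markov's inequality then bounds the delay moments from below.

  Upper bound: keeping only the \<open>k\<close>-th summand of the statistic, \<open>T\<^sub>A > k + n\<close> forces
  \<open>\<lambda>\<^bsub>k+n\<^esub>\<^bsup>k\<^esup> < ln A + \<bar>ln \<pi>\<^sub>k\<bar> + ln (w n)\<close>. For \<open>n \<ge> (ln A + \<bar>ln \<pi>\<^sub>k\<bar>) / (I + \<mu> - 2\<epsilon>)\<close> the right-hand side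
  is below \<open>(I - \<epsilon>) n\<close>, so the excess over that time is controlled by \<open>\<Upsilon>\<^sub>k\<^sub>,\<^sub>r(\<epsilon>)\<close>, while the
  contribution of \<open>\<bar>ln \<pi>\<^sub>k\<bar>\<close> has a finite prior moment of order \<open>r\<close>.
\<close>

section \<open>Powers and limits of ratios\<close>

text \<open>The split at \<open>b = \<eta> * a\<close> bounds the sum by a multiple of its dominant
  part. For small \<open>\<eta>\<close> the factor of \<open>a powr m\<close> is close to 1, which
  keeps the leading constant of the upper bound sharp; the price is a large factor on the
  lower-order part \<open>b\<close>.\<close>

lemma powr_add_le:
  fixes a b \<eta> m :: real
  assumes "0 \<le> a" "0 \<le> b" "0 < \<eta>" "0 \<le> m"
  shows "(a + b) powr m \<le> (1 + \<eta>) powr m * a powr m + (1 + 1 / \<eta>) powr m * b powr m"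
proof (cases "b \<le> \<eta> * a")
  case True
  then have "(a + b) powr m \<le> ((1 + \<eta>) * a) powr m"
    using assms by (intro powr_mono2) (auto simp: algebra_simps)
  also have "\<dots> = (1 + \<eta>) powr m * a powr m" using assms by (simp add: powr_mult)
  finally show ?thesis by (simp add: add_increasing2)
next
  case False
  then have "a \<le> b / \<eta>" using assms by (simp add: field_simps)
  then have "(a + b) powr m \<le> ((1 + 1 / \<eta>) * b) powr m"
    using assms by (intro powr_mono2) (auto simp: algebra_simps)
  also have "\<dots> = (1 + 1 / \<eta>) powr m * b powr m" using assms by (simp add: powr_mult)
  finally show ?thesis by (simp add: add_increasing)
qed

lemma filterlim_powr_at_top:
  assumes "0 < (m :: real)"
  shows "filterlim (\<lambda>x. x powr m) at_top at_top"
proof -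
  have "filterlim (\<lambda>x. exp (m * ln x)) at_top at_top"
    using assms by (intro filterlim_compose[OF exp_at_top] filterlim_tendsto_pos_mult_at_top[OF tendsto_const _ ln_at_top])
  moreover have "\<forall>\<^sub>F x in at_top. exp (m * ln x) = x powr m"
    using eventually_gt_at_top[of 0] by eventually_elim (simp add: powr_def)
  ultimately show ?thesis by (subst (asm) filterlim_cong) auto
qed

text \<open>By convexity the graph lies below its chord between \<open>x = 0\<close> and
  \<open>x = 1\<close>, whose slope is \<open>2 ^ p - 1\<close>.\<close>

lemma power_one_plus_le:
  fixes x :: real
  assumes "0 \<le> x" "x \<le> 1"
  shows "(1 + x) ^ p \<le> 1 + (2 ^ p - 1) * x"
proof (induction p)
  case (Suc p)
  have "(1 + x) ^ Suc p \<le> (1 + (2 ^ p - 1) * x) * (1 + x)"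
    using Suc assms by (simp add: mult_right_mono mult.commute)
  also have "\<dots> = 1 + 2 ^ p * x + (2 ^ p - 1) * (x * x)" by (simp add: algebra_simps)
  also have "\<dots> \<le> 1 + 2 ^ p * x + (2 ^ p - 1) * x"
    using assms by (intro add_left_mono mult_left_mono mult_left_le) auto
  finally show ?case by (simp add: algebra_simps)
qed simp

text \<open>A discrete derivative: the increment is of order \<open>n powr (m - 1)\<close>, hence at
  most of order \<open>n powr (r - 1)\<close>, which is the weight occurring in
  \<open>Upsilon\<close>.\<close>

lemma powr_Suc_increment:
  fixes m r :: real
  assumes "0 < m" "m \<le> r"
  obtains c where "0 \<le> c"
    "\<And>n. 1 \<le> n \<Longrightarrow> real (Suc n) powr m \<le> real n powr m + c * real n powr (r - 1)"
proof -
  \<comment> \<open>Rounding the exponent up to a natural number makes the chord bound for natural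
    powers available.\<close>
  define p where "p = nat \<lceil>m\<rceil>"
  have p: "m \<le> real p" unfolding p_def by linarith
  have "real (Suc n) powr m \<le> real n powr m + (2 ^ p - 1) * real n powr (r - 1)" if n: "1 \<le> n" for n
  proof -
    have x: "0 \<le> 1 / real n" "1 / real n \<le> 1" using n by auto
    have "real (Suc n) powr m = (real n * (1 + 1 / real n)) powr m" using n by (simp add: distrib_left add.commute)
    also have "\<dots> = real n powr m * (1 + 1 / real n) powr m" by (simp add: powr_mult)
    also have "(1 + 1 / real n) powr m \<le> (1 + 1 / real n) powr real p"
      using x p by (intro powr_mono) auto
    also have "\<dots> = (1 + 1 / real n) ^ p" using x by (intro powr_realpow) linarith
    also have "\<dots> \<le> 1 + (2 ^ p - 1) * (1 / real n)" using x by (rule power_one_plus_le)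
    finally have "real (Suc n) powr m \<le> real n powr m * (1 + (2 ^ p - 1) * (1 / real n))"
      by (simp add: mult_left_mono)
    also have "\<dots> = real n powr m + (2 ^ p - 1) * real n powr (m - 1)"
      using n by (simp add: field_simps powr_diff)
    also have "\<dots> \<le> real n powr m + (2 ^ p - 1) * real n powr (r - 1)"
      using n assms by (intro add_left_mono mult_left_mono powr_mono) auto
    finally show ?thesis .
  qed
  then show ?thesis using that[of "2 ^ p - 1"] by simp
qed

text \<open>Telescoping from \<open>N\<close> up to \<open>Y\<close> with the increment bound
  \<open>c(2)\<close>. Writing the sum as a series of indicators of \<open>n < Y\<close> prepares
  termwise integration, and covers infinite \<open>Y\<close> as well.\<close>

lemma enat_powr_le_tail_series:
  fixes m r c :: real
  assumes m: "0 < m" and N: "1 \<le> N" and c: "0 \<le> c"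
    "\<And>n. 1 \<le> n \<Longrightarrow> real (Suc n) powr m \<le> real n powr m + c * real n powr (r - 1)"
  shows "enat_powr Y m \<le> ennreal (real N powr m) +
    (\<Sum>j. if N \<le> Suc j \<and> enat (Suc j) < Y then ennreal (c * real (Suc j) powr (r - 1)) else 0)"
    (is "_ \<le> _ + ?S Y")
proof -
  have fin: "ennreal (real y powr m) \<le> ennreal (real N powr m) + ?S (enat y)" for y
  proof (cases "y \<le> N")
    case True
    then have "ennreal (real y powr m) \<le> ennreal (real N powr m)"
      using m by (intro ennreal_leI powr_mono2) auto
    then show ?thesis by (rule add_increasing2[rotated]) simp
  next
    case False
    let ?f = "\<lambda>n. c * real n powr (r - 1)"
    have f: "0 \<le> ?f n" for n using c by simp
    have "real y powr m \<le> real N powr m + (\<Sum>n\<in>{N..<y}. ?f n)" if "N \<le> y" for y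
      using that
    proof (induction y rule: dec_induct)
      case (step n)
      then show ?case using c(2)[of n] N by simp
    qed simp
    then have "ennreal (real y powr m) \<le> ennreal (real N powr m + (\<Sum>n\<in>{N..<y}. ?f n))"
      using False by (intro ennreal_leI) auto
    also have "\<dots> = ennreal (real N powr m) + (\<Sum>n\<in>{N..<y}. ennreal (?f n))"
      using f by (subst ennreal_plus) (auto simp: sum_nonneg)
    \<comment> \<open>The series is indexed by \<open>j\<close> with \<open>n = Suc j\<close>, so
      that \<open>n\<close> runs through the positive integers.\<close>
    also have "(\<Sum>n\<in>{N..<y}. ennreal (?f n)) =
        (\<Sum>j\<in>{N-1..<y-1}. if N \<le> Suc j \<and> enat (Suc j) < enat y then ennreal (?f (Suc j)) else 0)"
      using N by (intro sum.reindex_bij_witness[of _ Suc "\<lambda>n. n - 1"]) auto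
    also have "\<dots> \<le> ?S (enat y)" by (intro sum_le_suminf) auto
    finally show ?thesis by (simp add: add_left_mono)
  qed
  show ?thesis
  proof (cases Y)
    case (enat y)
    then show ?thesis using fin[of y] by (simp add: enat_powr_def)
  next
    case infinity
    \<comment> \<open>The bound for finite values is monotone in \<open>Y\<close> on the right;
      letting \<open>y\<close> grow forces the right-hand side at \<open>\<infinity>\<close> to be
      infinite.\<close>
    have "ennreal (real y powr m) \<le> ennreal (real N powr m) + ?S \<infinity>" for y
    proof -
      have "?S (enat y) \<le> ?S \<infinity>" by (intro suminf_le) auto
      then show ?thesis using fin[of y] by (meson add_left_mono order_trans)
    qed
    moreover have "(\<lambda>y. ennreal (real y powr m)) \<longlonglongrightarrow> top"
      unfolding ennreal_tendsto_top_eq_at_top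
      by (rule filterlim_compose[OF filterlim_powr_at_top[OF m] filterlim_real_sequentially])
    ultimately have "top \<le> ennreal (real N powr m) + ?S \<infinity>"
      by (intro LIMSEQ_le_const2) auto
    then show ?thesis using infinity by (simp add: enat_powr_def)
  qed
qed

text \<open>A sandwich criterion: it suffices to bound \<open>f\<close> by multiples of
  \<open>h\<close> with constants arbitrarily close to \<open>c0\<close> from each side. This is the
  form in which the delay bounds are obtained.\<close>

lemma tendsto_ennreal_ratio:
  fixes f :: "'c \<Rightarrow> ennreal" and h :: "'c \<Rightarrow> real"
  assumes "0 < c0" and h: "\<forall>\<^sub>F x in F. 0 < h x"
    and lo: "\<And>c. 0 < c \<Longrightarrow> c < c0 \<Longrightarrow> \<forall>\<^sub>F x in F. ennreal (c * h x) \<le> f x"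
    and hi: "\<And>c. c0 < c \<Longrightarrow> \<forall>\<^sub>F x in F. f x \<le> ennreal (c * h x)"
  shows "((\<lambda>x. f x / ennreal (h x)) \<longlongrightarrow> ennreal c0) F"
proof (rule order_tendstoI)
  fix a :: ennreal assume a: "a < ennreal c0"
  obtain a' where a': "a = ennreal a'" "0 \<le> a'" using a by (cases a) auto
  then have "a' < c0" using a \<open>0 < c0\<close> by (simp add: ennreal_less_iff)
  define c where "c = (a' + c0) / 2"
  have c: "0 < c" "c < c0" "a' < c" using a' \<open>a' < c0\<close> \<open>0 < c0\<close> by (auto simp: c_def)
  show "\<forall>\<^sub>F x in F. a < f x / ennreal (h x)"
    using h lo[OF c(1,2)]
  proof eventually_elim
    case (elim x)
    have "a < ennreal c" using a' c by (simp add: ennreal_less_iff)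
    also have "ennreal c = ennreal (c * h x) / ennreal (h x)" using elim c by (subst divide_ennreal) auto
    also have "\<dots> \<le> f x / ennreal (h x)" using elim by (intro divide_right_mono_ennreal)
    finally show ?case .
  qed
next
  fix a :: ennreal assume a: "ennreal c0 < a"
  then obtain y where y: "ennreal c0 < y" "y < a" using dense by blast
  then obtain c where c: "y = ennreal c" "0 \<le> c" by (cases y) auto
  then have "c0 < c" using y \<open>0 < c0\<close> by (simp add: ennreal_less_iff)
  show "\<forall>\<^sub>F x in F. f x / ennreal (h x) < a"
    using h hi[OF \<open>c0 < c\<close>]
  proof eventually_elim
    case (elim x)
    have "f x / ennreal (h x) \<le> ennreal (c * h x) / ennreal (h x)" using elim by (intro divide_right_mono_ennreal)
    also have "\<dots> = ennreal c" using elim c by (subst divide_ennreal) auto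
    also have "\<dots> < a" using y c by simp
    finally show ?case .
  qed
qed

text \<open>As the common limit \<open>c0\<close> is finite and positive, both functions are
  eventually finite and nonzero. The quotient can therefore be formed in the reals, where division
  is continuous and \<open>h\<close> cancels.\<close>

lemma ratio_equiv_of_common_limit:
  fixes f g :: "'c \<Rightarrow> ennreal" and h :: "'c \<Rightarrow> real"
  assumes c0: "0 < c0" and h: "\<forall>\<^sub>F x in F. 0 < h x"
    and f: "((\<lambda>x. f x / ennreal (h x)) \<longlongrightarrow> ennreal c0) F"
    and g: "((\<lambda>x. g x / ennreal (h x)) \<longlongrightarrow> ennreal c0) F"
  shows "ratio_equiv f F g"
proof -
  have lim: "((\<lambda>x. enn2real (k x / ennreal (h x))) \<longlongrightarrow> c0) F" "\<forall>\<^sub>F x in F. k x < top"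
    if k: "((\<lambda>x. k x / ennreal (h x)) \<longlongrightarrow> ennreal c0) F" for k
  proof -
    show "((\<lambda>x. enn2real (k x / ennreal (h x))) \<longlongrightarrow> c0) F"
      using tendsto_enn2real[OF k] c0 by simp
    have "\<forall>\<^sub>F x in F. k x / ennreal (h x) < top" by (rule order_tendstoD(2)[OF k]) simp
    then show "\<forall>\<^sub>F x in F. k x < top"
      by eventually_elim (metis ennreal_divide_eq_top_iff ennreal_neq_top less_top)
  qed
  have "((\<lambda>x. enn2real (f x / ennreal (h x)) / enn2real (g x / ennreal (h x))) \<longlongrightarrow> c0 / c0) F"
    using c0 by (intro tendsto_divide lim f g) auto
  then have "((\<lambda>x. ennreal (enn2real (f x / ennreal (h x)) / enn2real (g x / ennreal (h x)))) \<longlongrightarrow> ennreal (c0 / c0)) F"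
    by (rule tendsto_ennrealI)
  moreover have "\<forall>\<^sub>F x in F. 0 < enn2real (g x / ennreal (h x))"
    using order_tendstoD(1)[OF lim(1)[OF g] c0] .
  with h lim(2)[OF f] lim(2)[OF g]
  have "\<forall>\<^sub>F x in F. ennreal (enn2real (f x / ennreal (h x)) / enn2real (g x / ennreal (h x))) = f x / g x"
  proof eventually_elim
    case (elim x)
    obtain u v where uv: "f x = ennreal u" "0 \<le> u" "g x = ennreal v" "0 \<le> v"
      using elim by (cases "f x"; cases "g x") auto
    then have "0 < v" using elim by (cases "v = 0") auto
    then show ?case using uv elim by (simp add: divide_ennreal)
  qed
  ultimately show ?thesis unfolding ratio_equiv_def
    using c0 by (auto elim: Lim_transform_eventually)
qed

lemma filterlim_abs_ln_at_right_0: "filterlim (\<lambda>\<alpha>::real. \<bar>ln \<alpha>\<bar>) at_top (at_right 0)"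
proof (rule filterlim_at_top_mono)
  show "filterlim (\<lambda>\<alpha>::real. - ln \<alpha>) at_top (at_right 0)"
    using ln_at_0 by (simp add: filterlim_uminus_at_top)
qed (auto intro: always_eventually)

text \<open>Allows the denominator \<open>1 - PFA\<close> of the delay moment to be dropped in lower
  bounds.\<close>

lemma le_ennreal_divide:
  fixes x y :: ennreal
  assumes "y \<le> 1" shows "x \<le> x / y"
proof (cases "y = 0")
  case False
  obtain y' where y: "y = ennreal y'" "0 < y'" "y' \<le> 1"
    using assms False by (cases y) (auto simp: less_le top_unique)
  show ?thesis
  proof (cases x)
    case (real x')
    then show ?thesis using y by (simp add: divide_ennreal le_divide_eq mult_left_le)
  qed (use y in \<open>simp add: ennreal_top_divide\<close>)
qed simp

section \<open>The prior\<close>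

lemma prior_tail_sums:
  "(\<lambda>j. prior_mass prior (j + n)) sums measure_pmf.prob prior {int n..}"
proof -
  have "(\<lambda>j. measure_pmf.prob prior {int (j + n)}) sums measure_pmf.prob prior (\<Union>j. {int (j + n)})"
    by (rule measure_pmf.finite_measure_UNION) (auto simp: disjoint_family_on_def)
  moreover have "(\<Union>j. {int (j + n)}) = {int n..}"
  proof (intro set_eqI iffI)
    fix x assume "x \<in> {int n..}"
    then show "x \<in> (\<Union>j. {int (j + n)})" by (intro UN_I[of "nat (x - int n)"]) auto
  qed auto
  ultimately show ?thesis by (simp add: prior_mass_def measure_pmf_single)
qed

lemma prior_mass_nonneg [simp]: "0 \<le> prior_mass prior k"
  by (simp add: prior_mass_def)

lemma prior_mass_le_1: "prior_mass prior k \<le> 1"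
  by (simp add: prior_mass_def pmf_le_1)

lemma prior_total: "measure_pmf.prob prior {int 0..} = 1 - prior_neg prior"
  unfolding prior_neg_def using measure_pmf.prob_compl[of "{..<0}" prior]
  by (simp add: Compl_eq_Diff_UNIV[symmetric] Compl_lessThan)

lemma prior_cdf_tail: "1 - prior_cdf prior n = measure_pmf.prob prior {int (Suc n)..}"
proof -
  have "UNIV - {..int n} = {int (Suc n)..}" by auto
  then show ?thesis unfolding prior_cdf_def using measure_pmf.prob_compl[of "{..int n}" prior] by simp
qed

lemma prior_tail_antimono: "m \<le> n \<Longrightarrow> measure_pmf.prob prior {int n..} \<le> measure_pmf.prob prior {int m..}"
  by (intro measure_pmf.finite_measure_mono) auto

lemma prior_mass_le_tail: "prior_mass prior k \<le> measure_pmf.prob prior {int k..}"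
  unfolding prior_mass_def measure_pmf_single[symmetric]
  by (intro measure_pmf.finite_measure_mono) auto

lemma prior_tail_pos:
  assumes "\<And>n. prior_cdf prior n < 1"
  shows "0 < measure_pmf.prob prior {int n..}"
proof -
  have "0 < measure_pmf.prob prior {int (Suc n)..}" using assms[of n] prior_cdf_tail[of prior n] by simp
  also have "\<dots> \<le> measure_pmf.prob prior {int n..}" by (rule prior_tail_antimono) simp
  finally show ?thesis .
qed

text \<open>The complement of the distribution function at \<open>n\<close> is the tail from
  \<open>Suc n\<close> on, so the index shifts by one; the factor \<open>n / Suc n\<close> tends to
  1 and repairs the normalisation.\<close>

lemma prior_tail_exponent:
  assumes pos: "\<And>n. prior_cdf prior n < 1"
    and tail: "(\<lambda>n. \<bar>ln (1 - prior_cdf prior n)\<bar> / real n) \<longlonglongrightarrow> \<mu>"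
  shows "(\<lambda>n. - ln (measure_pmf.prob prior {int n..}) / real n) \<longlonglongrightarrow> \<mu>"
proof -
  let ?w = "\<lambda>n. measure_pmf.prob prior {int n..}"
  have "(\<lambda>n. real n / real (Suc n)) \<longlonglongrightarrow> 1" by (rule LIMSEQ_n_over_Suc_n)
  from tendsto_mult[OF tail this]
  have "(\<lambda>n. \<bar>ln (1 - prior_cdf prior n)\<bar> / real n * (real n / real (Suc n))) \<longlonglongrightarrow> \<mu>" by simp
  moreover have "\<forall>\<^sub>F n in sequentially. \<bar>ln (1 - prior_cdf prior n)\<bar> / real n * (real n / real (Suc n))
      = - ln (?w (Suc n)) / real (Suc n)"
    using eventually_gt_at_top[of 0]
  proof eventually_elim
    case (elim n)
    have "ln (?w (Suc n)) \<le> 0" using prior_tail_pos[OF pos, of "Suc n"] by simp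
    then have "\<bar>ln (1 - prior_cdf prior n)\<bar> = - ln (?w (Suc n))" unfolding prior_cdf_tail by simp
    then show ?case using elim by simp
  qed
  ultimately have "(\<lambda>n. - ln (?w (Suc n)) / real (Suc n)) \<longlonglongrightarrow> \<mu>"
    by (rule Lim_transform_eventually)
  then show ?thesis by (subst (asm) filterlim_sequentially_Suc)
qed

text \<open>For positive \<open>\<mu>\<close> the logarithmic moment is finite automatically:
  \<open>x * \<bar>ln x\<bar> powr r\<close> is at most a constant times the square root of
  \<open>x\<close>, and the prior masses are eventually below \<open>exp (- \<mu> * n / 2)\<close>,
  so a geometric series with ratio \<open>exp (- \<mu> / 4)\<close> dominates.\<close>

lemma summable_prior_log_moment:
  fixes r \<mu> :: real
  assumes pos: "\<And>n. prior_cdf prior n < 1"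
    and tail: "(\<lambda>n. \<bar>ln (1 - prior_cdf prior n)\<bar> / real n) \<longlonglongrightarrow> \<mu>"
    and \<mu>: "0 < \<mu>" and r: "0 < r"
  shows "summable (\<lambda>k. prior_mass prior k * \<bar>ln (prior_mass prior k)\<bar> powr r)"
proof -
  let ?\<pi> = "prior_mass prior" and ?w = "\<lambda>n. measure_pmf.prob prior {int n..}"
  have bound: "x * \<bar>ln x\<bar> powr r \<le> (2 powr r * r powr r) * x powr (1/2)" if x: "0 \<le> x" "x \<le> 1" for x :: real
  proof (cases "x = 0 \<or> x = 1")
    case False
    then have x: "0 < x" "x < 1" using x by auto
    \<comment> \<open>For \<open>x\<close> in the open unit interval this exceeds 1, where a power
      of the logarithm is bounded by a multiple of its argument; multiplied by \<open>x\<close> it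
      leaves the square root of \<open>x\<close>.\<close>
    let ?y = "x powr (- (1/2))"
    have "1 < ?y" using x powr_less_mono'[of x "-(1/2)" 0] by simp
    then have "ln ?y powr r \<le> r powr r * ?y" using r by (rule ln_powr_bound2)
    moreover have "\<bar>ln x\<bar> = 2 * ln ?y" using x by (simp add: ln_powr)
    moreover have "0 \<le> ln ?y" using \<open>1 < ?y\<close> by (intro ln_ge_zero) simp
    ultimately have "\<bar>ln x\<bar> powr r \<le> 2 powr r * (r powr r * ?y)"
      by (simp only: powr_mult) (intro mult_left_mono, auto)
    then have "x * \<bar>ln x\<bar> powr r \<le> x * (2 powr r * (r powr r * ?y))" using x by (intro mult_left_mono) auto
    also have "\<dots> = 2 powr r * r powr r * (x * ?y)" by (simp only: mult_ac)
    also have "x * ?y = x powr (1/2)" using x by (simp add: powr_mult_base)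
    finally show ?thesis .
  qed auto
  have "\<forall>\<^sub>F n in sequentially. \<mu> / 2 < - ln (?w n) / real n"
    using prior_tail_exponent[OF pos tail] by (rule order_tendstoD(1)) (use \<mu> in simp)
  then have "\<forall>\<^sub>F n in sequentially. norm (?\<pi> n * \<bar>ln (?\<pi> n)\<bar> powr r) \<le> (2 powr r * r powr r) * exp (- (\<mu> / 4)) ^ n"
    using eventually_gt_at_top[of 0]
  proof eventually_elim
    case (elim n)
    have w: "0 < ?w n" by (rule prior_tail_pos[OF pos])
    have "ln (?w n) < - (\<mu> / 2) * real n" using elim by (simp add: field_simps)
    then have "?w n \<le> exp (- (\<mu> / 2) * real n)" using w by (metis exp_less_mono exp_ln less_imp_le)
    then have "?\<pi> n \<le> exp (- (\<mu> / 2) * real n)" using prior_mass_le_tail[of prior n] by linarith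
    then have "?\<pi> n powr (1/2) \<le> exp (- (\<mu> / 2) * real n) powr (1/2)" by (intro powr_mono2) auto
    also have "\<dots> = exp (- (\<mu> / 4) * real n)" by (simp add: powr_def)
    also have "\<dots> = exp (- (\<mu> / 4)) ^ n" by (metis exp_of_nat_mult mult.commute)
    finally have "(2 powr r * r powr r) * ?\<pi> n powr (1/2) \<le> (2 powr r * r powr r) * exp (- (\<mu> / 4)) ^ n"
      by (intro mult_left_mono) auto
    with bound[of "?\<pi> n"] have "?\<pi> n * \<bar>ln (?\<pi> n)\<bar> powr r \<le> (2 powr r * r powr r) * exp (- (\<mu> / 4)) ^ n"
      using prior_mass_le_1[of prior n] by (intro order_trans[OF bound]) auto
    then show ?case by simp
  qed
  moreover have "summable (\<lambda>n. (2 powr r * r powr r) * exp (- (\<mu> / 4)) ^ n)"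
    using \<mu> by (intro summable_mult summable_geometric) auto
  ultimately show ?thesis by (rule summable_comparison_test_ev)
qed

text \<open>Here \<open>b + d * \<bar>ln \<pi>\<bar>\<close>, with \<open>\<pi>\<close> the prior
  mass at \<open>k\<close>, stands for the part of the waiting time that does not grow with the
  threshold. Powers up to \<open>r\<close> are controlled by
  \<open>1 + \<bar>ln \<pi>\<bar> powr r\<close>.\<close>

lemma summable_prior_affine_moment:
  fixes m r b d :: real
  assumes log: "summable (\<lambda>k. prior_mass prior k * \<bar>ln (prior_mass prior k)\<bar> powr r)"
    and m: "0 < m" "m \<le> r" and bd: "0 \<le> b" "0 \<le> d"
  shows "summable (\<lambda>k. prior_mass prior k * (b + d * \<bar>ln (prior_mass prior k)\<bar>) powr m)"
proof (rule summable_comparison_test'[where N = 0])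
  let ?l = "\<lambda>k. \<bar>ln (prior_mass prior k)\<bar>" and ?\<pi> = "prior_mass prior"
  let ?C = "2 powr m * b powr m + 2 powr m * d powr m" and ?D = "2 powr m * d powr m"
  show "summable (\<lambda>k. ?C * ?\<pi> k + ?D * (?\<pi> k * ?l k powr r))"
    using prior_tail_sums[of prior 0] log by (intro summable_add summable_mult) (auto simp: sums_iff)
  fix k :: nat
  have "?l k powr m \<le> 1 + ?l k powr r"
  proof (cases "?l k \<le> 1")
    case True
    then have "?l k powr m \<le> 1 powr m" using m by (intro powr_mono2) auto
    then show ?thesis by (simp add: add_increasing2)
  next
    case False
    then have "?l k powr m \<le> ?l k powr r" using m by (intro powr_mono) auto
    then show ?thesis by simp
  qed
  moreover have "(b + d * ?l k) powr m \<le> 2 powr m * b powr m + 2 powr m * (d * ?l k) powr m"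
    using powr_add_le[of b "d * ?l k" 1 m] m bd by simp
  moreover have "(d * ?l k) powr m = d powr m * ?l k powr m" by (simp add: powr_mult)
  ultimately have "(b + d * ?l k) powr m \<le> 2 powr m * b powr m + 2 powr m * (d powr m * (1 + ?l k powr r))"
    by (smt (verit) mult_left_mono powr_ge_zero)
  then have "?\<pi> k * (b + d * ?l k) powr m \<le> ?\<pi> k * (2 powr m * b powr m + 2 powr m * (d powr m * (1 + ?l k powr r)))"
    by (intro mult_left_mono) auto
  also have "\<dots> = ?C * ?\<pi> k + ?D * (?\<pi> k * ?l k powr r)" by (simp add: algebra_simps)
  finally show "norm (?\<pi> k * (b + d * ?l k) powr m) \<le> ?C * ?\<pi> k + ?D * (?\<pi> k * ?l k powr r)" by simp
qed

section \<open>Change of measure\<close>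

lemma INF_enat_le_iff: "(INF n\<in>B. enat n) \<le> enat m \<longleftrightarrow> (\<exists>n\<in>B. n \<le> m)"
proof
  assume *: "(INF n\<in>B. enat n) \<le> enat m"
  show "\<exists>n\<in>B. n \<le> m"
  proof (rule ccontr)
    assume "\<not> ?thesis"
    then have "enat (Suc m) \<le> (INF n\<in>B. enat n)"
      by (intro INF_greatest) (auto simp: not_le Suc_le_eq)
    then have "enat (Suc m) \<le> enat m" using * by (rule order_trans)
    then show False by simp
  qed
qed (auto intro: INF_lower2)

lemma shiryaev_le_iff:
  "shiryaev prior L A \<omega> \<le> enat n \<longleftrightarrow> (\<exists>j\<in>{1..n}. A \<le> shiryaev_stat prior L j \<omega>)"
  unfolding shiryaev_def INF_enat_le_iff by auto

text \<open>A finite infimum of natural numbers is attained, so the statistic has crossed the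
  threshold at the stopping time itself.\<close>

lemma shiryaev_eqD:
  assumes "shiryaev prior L A \<omega> = enat n"
  shows "1 \<le> n" "A \<le> shiryaev_stat prior L n \<omega>"
proof -
  obtain j where j: "j \<in> {1..n}" "A \<le> shiryaev_stat prior L j \<omega>"
    using shiryaev_le_iff[of prior L A \<omega> n] assms by auto
  then have "shiryaev prior L A \<omega> \<le> enat j" unfolding shiryaev_le_iff by auto
  then have "j = n" using assms j by auto
  then show "1 \<le> n" "A \<le> shiryaev_stat prior L n \<omega>" using j by auto
qed

context changepoint_model
begin

section \<open>The observation filtration and the joint densities\<close>

abbreviation Flt :: "nat \<Rightarrow> 'a measure" where
  "Flt n \<equiv> obs_filtration (space Pinf) S X (enat n)"

abbreviation LR :: "nat \<Rightarrow> nat \<Rightarrow> 'a \<Rightarrow> real" where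
  "LR \<equiv> lik_ratio pinf p0 X"

definition cond_dens :: "nat \<Rightarrow> nat \<Rightarrow> (nat \<Rightarrow> 'b) \<Rightarrow> real" where
  "cond_dens k i x = (if i \<le> k then pinf i (restrict x {1..<i}) (x i) else p0 k i (restrict x {1..<i}) (x i))"

text \<open>With \<open>k = n\<close> only pre-change factors remain, so \<open>dens n n\<close> is
  the density of the first \<open>n\<close> observations under \<open>Pinf\<close> and one family
  covers all the measures.\<close>

definition dens :: "nat \<Rightarrow> nat \<Rightarrow> (nat \<Rightarrow> 'b) \<Rightarrow> real" where
  "dens k n x = (\<Prod>i\<in>{1..n}. cond_dens k i x)"

lemma space_P [simp]: "space (P k) = space Pinf"
  using sets_P sets_eq_imp_space_eq by blast

lemma obs_index: "{j. 1 \<le> j \<and> enat j \<le> enat n} = {1..n}"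
  by auto

lemma Flt_eq: "Flt n = vimage_algebra (space Pinf) (obs_vec X {1..n}) (PiM {1..n} (\<lambda>_. S))"
  unfolding obs_filtration_def obs_index ..

lemma space_Flt [simp]: "space (Flt n) = space Pinf"
  by (simp add: Flt_eq)

lemma measurable_obs_vec: "obs_vec X {1..n} \<in> measurable Pinf (PiM {1..n} (\<lambda>_. S))"
proof -
  have eq: "obs_vec X {1..n} = (\<lambda>\<omega>. \<lambda>j\<in>{1..n}. X j \<omega>)" by (rule ext) (simp add: obs_vec_def)
  show ?thesis unfolding eq by (rule measurable_restrict) (use measurable_X in auto)
qed

lemma obs_vec_Flt: "obs_vec X {1..n} \<in> measurable (Flt n) (PiM {1..n} (\<lambda>_. S))"
  unfolding Flt_eq using measurable_space[OF measurable_obs_vec]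
  by (intro measurable_vimage_algebra1) blast

lemma sets_Flt:
  "sets (Flt n) = {obs_vec X {1..n} -` B \<inter> space Pinf | B. B \<in> sets (PiM {1..n} (\<lambda>_. S))}"
  unfolding Flt_eq using measurable_space[OF measurable_obs_vec] by (intro sets_vimage_algebra2) blast

lemma sets_Flt_subset: "sets (Flt n) \<subseteq> sets Pinf"
  unfolding sets_Flt using measurable_sets[OF measurable_obs_vec] by auto

lemma measurable_Flt_imp: "f \<in> measurable (Flt n) N \<Longrightarrow> f \<in> measurable Pinf N"
  using sets_Flt_subset[of n] by (auto simp: measurable_def)

lemma measurable_restr_coord:
  fixes i n :: nat
  assumes "(\<lambda>(h, y). f h y) \<in> borel_measurable (PiM {1..<i} (\<lambda>_. S) \<Otimes>\<^sub>M S)" "1 \<le> i" "i \<le> n"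
  shows "(\<lambda>x. f (restrict x {1..<i}) (x i) :: real) \<in> borel_measurable (PiM {1..n} (\<lambda>_. S))"
proof -
  have 1: "(\<lambda>x. (restrict x {1..<i}, x i)) \<in> measurable (PiM {1..n} (\<lambda>_. S)) (PiM {1..<i} (\<lambda>_. S) \<Otimes>\<^sub>M S)"
    using assms(2,3) by (intro measurable_Pair measurable_restrict_subset measurable_component_singleton) auto
  show ?thesis using measurable_compose[OF 1 assms(1)] by simp
qed

lemma measurable_pinf': "1 \<le> i \<Longrightarrow> i \<le> n \<Longrightarrow>
    (\<lambda>x. pinf i (restrict x {1..<i}) (x i)) \<in> borel_measurable (PiM {1..n} (\<lambda>_. S))"
  by (rule measurable_restr_coord[OF measurable_pinf])

lemma measurable_p0': "1 \<le> i \<Longrightarrow> i \<le> n \<Longrightarrow> k < i \<Longrightarrow>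
    (\<lambda>x. p0 k i (restrict x {1..<i}) (x i)) \<in> borel_measurable (PiM {1..n} (\<lambda>_. S))"
  by (rule measurable_restr_coord[OF measurable_p0])

lemma cond_dens_nonneg: "1 \<le> i \<Longrightarrow> 0 \<le> cond_dens k i x"
  using pinf_nonneg p0_nonneg by (auto simp: cond_dens_def not_le)

lemma dens_nonneg: "0 \<le> dens k n x"
  unfolding dens_def by (intro prod_nonneg) (auto intro: cond_dens_nonneg)

lemma measurable_dens [measurable]: "dens k n \<in> borel_measurable (PiM {1..n} (\<lambda>_. S))"
proof -
  have "(\<lambda>x. \<Prod>i\<in>{1..n}. cond_dens k i x) \<in> borel_measurable (PiM {1..n} (\<lambda>_. S))"
  proof (intro borel_measurable_prod)
    fix i assume "i \<in> {1..n}"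
    then show "cond_dens k i \<in> borel_measurable (PiM {1..n} (\<lambda>_. S))"
      unfolding cond_dens_def using measurable_pinf'[of i n] measurable_p0'[of i n k] by (cases "i \<le> k") auto
  qed
  then show ?thesis by (simp add: dens_def[abs_def])
qed

lemma distributed_Pinf: "1 \<le> n \<Longrightarrow> distributed Pinf (PiM {1..n} (\<lambda>_. S)) (obs_vec X {1..n}) (\<lambda>x. ennreal (dens n n x))"
proof -
  assume n: "1 \<le> n"
  have "dens n n x = (\<Prod>i\<in>{1..n}. pinf i (restrict x {1..<i}) (x i))" for x
    unfolding dens_def by (intro prod.cong) (auto simp: cond_dens_def)
  then show ?thesis using density_Pinf[OF n] by simp
qed

lemma distributed_P: "1 \<le> n \<Longrightarrow> distributed (P k) (PiM {1..n} (\<lambda>_. S)) (obs_vec X {1..n}) (\<lambda>x. ennreal (dens k n x))"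
  using density_P[of n k] unfolding dens_def cond_dens_def .

section \<open>Absolute continuity and the change of measure\<close>

lemma null_sets_Flt_iff:
  assumes "1 \<le> n" "E \<in> sets (Flt n)"
  shows "E \<in> null_sets (P k) \<longleftrightarrow> E \<in> null_sets Pinf"
proof -
  have sub: "subalgebra M (Flt n)" if "sets M = sets Pinf" for M
    using sets_Flt_subset that sets_eq_imp_space_eq[OF that] unfolding subalgebra_def by auto
  show ?thesis
    using mutually_abs_cont[OF assms(1), of k] assms(2)
      null_sets_restr_to_subalg[OF sub[OF sets_P[of k]]] null_sets_restr_to_subalg[OF sub[OF refl]]
    unfolding mutually_abs_cont_on_def absolutely_continuous_def by auto
qed

text \<open>The event that the no-change density vanishes at the observations is
  \<open>Pinf\<close>-null, hence \<open>P k\<close>-null by mutual absolute continuity, so the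
  integral of \<open>dens k n\<close> over the zero set is 0.\<close>

lemma AE_dens_zero:
  assumes "1 \<le> n"
  shows "AE x in PiM {1..n} (\<lambda>_. S). dens n n x = 0 \<longrightarrow> dens k n x = 0"
proof -
  let ?N = "PiM {1..n} (\<lambda>_. S)"
  let ?B = "{x \<in> space ?N. dens n n x = 0}"
  have B: "?B \<in> sets ?N" by measurable
  let ?E = "obs_vec X {1..n} -` ?B \<inter> space Pinf"
  have E: "?E \<in> sets (Flt n)" unfolding sets_Flt using B by blast
  have "emeasure Pinf ?E = (\<integral>\<^sup>+x. ennreal (dens n n x) * indicator ?B x \<partial>?N)"
    by (rule distributed_emeasure[OF distributed_Pinf[OF assms] B])
  also have "\<dots> = (\<integral>\<^sup>+x. 0 \<partial>?N)" by (intro nn_integral_cong) (auto split: split_indicator)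
  finally have "?E \<in> null_sets Pinf" using E sets_Flt_subset by (intro null_setsI) auto
  then have "?E \<in> null_sets (P k)" using null_sets_Flt_iff[OF assms E] by simp
  then have "emeasure (P k) ?E = 0" by (rule null_setsD1)
  also have "emeasure (P k) ?E = (\<integral>\<^sup>+x. ennreal (dens k n x) * indicator ?B x \<partial>?N)"
    using distributed_emeasure[OF distributed_P[OF assms] B] by simp
  finally have "AE x in ?N. ennreal (dens k n x) * indicator ?B x = 0"
    by (subst (asm) nn_integral_0_iff_AE) (use B in measurable)
  then show ?thesis using AE_space
    by eventually_elim (use dens_nonneg in \<open>auto simp: ennreal_eq_0_iff intro!: antisym\<close>)
qed

text \<open>The likelihood ratio as a function of the observed vector, the form in which it can be
  integrated against the product measure.\<close>

definition lik_ratio_of :: "nat \<Rightarrow> nat \<Rightarrow> (nat \<Rightarrow> 'b) \<Rightarrow> real" where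
  "lik_ratio_of k i x = p0 k i (restrict x {1..<i}) (x i) / pinf i (restrict x {1..<i}) (x i)"

lemma LR_eq: "1 \<le> i \<Longrightarrow> i \<le> n \<Longrightarrow> LR k i \<omega> = lik_ratio_of k i (obs_vec X {1..n} \<omega>)"
proof -
  assume "1 \<le> i" "i \<le> n"
  then have "restrict (obs_vec X {1..n} \<omega>) {1..<i} = obs_vec X {1..<i} \<omega>" "obs_vec X {1..n} \<omega> i = X i \<omega>"
    by (auto simp: obs_vec_def restrict_def)
  then show ?thesis by (simp add: lik_ratio_def lik_ratio_of_def)
qed

lemma measurable_lik_ratio_of: "1 \<le> i \<Longrightarrow> i \<le> n \<Longrightarrow> k < i \<Longrightarrow> lik_ratio_of k i \<in> borel_measurable (PiM {1..n} (\<lambda>_. S))"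
  unfolding lik_ratio_of_def using measurable_pinf'[of i n] measurable_p0'[of i n k] by measurable

lemma lik_ratio_of_nonneg: "k < i \<Longrightarrow> 0 \<le> lik_ratio_of k i x"
  unfolding lik_ratio_of_def using pinf_nonneg p0_nonneg by (intro divide_nonneg_nonneg) auto

lemma LR_nonneg: "k < i \<Longrightarrow> 0 \<le> LR k i \<omega>"
  using LR_eq[of i i] lik_ratio_of_nonneg by simp

lemma LR_Flt: "k < i \<Longrightarrow> i \<le> n \<Longrightarrow> LR k i \<in> borel_measurable (Flt n)"
proof -
  assume *: "k < i" "i \<le> n"
  then have "(\<lambda>\<omega>. lik_ratio_of k i (obs_vec X {1..n} \<omega>)) \<in> borel_measurable (Flt n)"
    by (intro measurable_compose[OF obs_vec_Flt] measurable_lik_ratio_of) auto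
  moreover have "LR k i = (\<lambda>\<omega>. lik_ratio_of k i (obs_vec X {1..n} \<omega>))" using * LR_eq by (intro ext) auto
  ultimately show ?thesis by simp
qed

lemma LR_measurable: "k < i \<Longrightarrow> LR k i \<in> borel_measurable Pinf"
  using measurable_Flt_imp[OF LR_Flt] by blast

lemma llr_Flt: "k + j \<le> n \<Longrightarrow> llr LR k j \<in> borel_measurable (Flt n)"
  unfolding llr_def[abs_def] by (intro borel_measurable_sum borel_measurable_ln LR_Flt) auto

lemma llr_measurable [measurable]: "llr LR k j \<in> borel_measurable Pinf"
  using measurable_Flt_imp[OF llr_Flt] by blast

lemma llr_measurable_P [measurable]: "llr LR k j \<in> borel_measurable (P k')"
  using llr_measurable by (simp add: measurable_cong_sets[OF sets_P refl])

text \<open>A nonzero product has nonzero factors, so the divisions by \<open>pinf\<close> in the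
  likelihood ratios cancel.\<close>

lemma dens_split:
  assumes "dens n n x \<noteq> 0" "k \<le> n"
  shows "dens k n x = dens n n x * (\<Prod>i\<in>{k+1..n}. lik_ratio_of k i x)"
proof -
  have nz: "pinf i (restrict x {1..<i}) (x i) \<noteq> 0" if "i \<in> {1..n}" for i
    using assms(1) that by (auto simp: dens_def cond_dens_def)
  have "(\<Prod>i\<in>{k+1..n}. lik_ratio_of k i x) = (\<Prod>i\<in>{1..n}. if i \<in> {k+1..n} then lik_ratio_of k i x else 1)"
    by (intro prod.mono_neutral_cong_left) auto
  then have "dens n n x * (\<Prod>i\<in>{k+1..n}. lik_ratio_of k i x) = (\<Prod>i\<in>{1..n}. cond_dens n i x * (if i \<in> {k+1..n} then lik_ratio_of k i x else 1))"
    by (simp add: dens_def prod.distrib)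
  also have "\<dots> = dens k n x" unfolding dens_def
    by (intro prod.cong) (use nz in \<open>auto simp: cond_dens_def lik_ratio_of_def\<close>)
  finally show ?thesis by simp
qed

text \<open>The product of likelihood ratios is the density of \<open>P k\<close> with respect to
  \<open>Pinf\<close> on the first \<open>n\<close> observations. The event is moved to the space of
  observation vectors, the density is factored there, and the result is moved back. For
  \<open>k = n\<close> the product is empty and the two measures agree.\<close>

lemma change_of_measure:
  assumes n: "1 \<le> n" and k: "k \<le> n" and E: "E \<in> sets (Flt n)"
  shows "emeasure (P k) E = (\<integral>\<^sup>+\<omega>. ennreal (\<Prod>i\<in>{k+1..n}. LR k i \<omega>) * indicator E \<omega> \<partial>Pinf)"
proof -
  let ?N = "PiM {1..n} (\<lambda>_. S)"
  obtain B where B: "B \<in> sets ?N" and E_eq: "E = obs_vec X {1..n} -` B \<inter> space Pinf"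
    using E unfolding sets_Flt by blast
  let ?g = "\<lambda>x. \<Prod>i\<in>{k+1..n}. lik_ratio_of k i x"
  have g[measurable]: "?g \<in> borel_measurable ?N"
    by (intro borel_measurable_prod measurable_lik_ratio_of) auto
  have "emeasure (P k) E = (\<integral>\<^sup>+x. ennreal (dens k n x) * indicator B x \<partial>?N)"
    using distributed_emeasure[OF distributed_P[OF n] B] by (simp add: E_eq)
  also have "\<dots> = (\<integral>\<^sup>+x. ennreal (dens n n x) * (ennreal (?g x) * indicator B x) \<partial>?N)"
  proof (rule nn_integral_cong_AE)
    show "AE x in ?N. ennreal (dens k n x) * indicator B x = ennreal (dens n n x) * (ennreal (?g x) * indicator B x)"
      using AE_dens_zero[OF n, of k]
    proof eventually_elim
      case (elim x)
      have "0 \<le> ?g x" by (intro prod_nonneg) (auto intro: lik_ratio_of_nonneg)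
      then have "ennreal (dens k n x) = ennreal (dens n n x) * ennreal (?g x)"
        \<comment> \<open>Where the no-change density vanishes, \<open>dens k n\<close> vanishes as
          well for almost every \<open>x\<close>, and both sides are 0.\<close>
        using dens_split[OF _ k, of x] elim dens_nonneg[of n n x]
        by (cases "dens n n x = 0") (auto simp: ennreal_mult)
      then show ?case by (simp add: mult.assoc)
    qed
  qed
  also have "\<dots> = (\<integral>\<^sup>+\<omega>. ennreal (?g (obs_vec X {1..n} \<omega>)) * indicator B (obs_vec X {1..n} \<omega>) \<partial>Pinf)"
    by (rule distributed_nn_integral[OF distributed_Pinf[OF n]]) (use B in measurable)
  also have "\<dots> = (\<integral>\<^sup>+\<omega>. ennreal (\<Prod>i\<in>{k+1..n}. LR k i \<omega>) * indicator E \<omega> \<partial>Pinf)"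
  proof (rule nn_integral_cong)
    fix \<omega> assume "\<omega> \<in> space Pinf"
    then have "indicator B (obs_vec X {1..n} \<omega>) = (indicator E \<omega> :: ennreal)"
      by (auto simp: E_eq split: split_indicator)
    moreover have "?g (obs_vec X {1..n} \<omega>) = (\<Prod>i\<in>{k+1..n}. LR k i \<omega>)"
      by (intro prod.cong) (auto simp: LR_eq[of _ n])
    ultimately show "ennreal (?g (obs_vec X {1..n} \<omega>)) * indicator B (obs_vec X {1..n} \<omega>) =
        ennreal (\<Prod>i\<in>{k+1..n}. LR k i \<omega>) * indicator E \<omega>" by simp
  qed
  finally show ?thesis .
qed

text \<open>On the event that a factor is 0 the change-of-measure weight is 0, so the event has
  \<open>P k\<close>-probability 0. This makes \<open>exp (llr LR k n \<omega>)\<close> almost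
  surely equal to the product of likelihood ratios, in spite of the convention
  \<open>ln 0 = 0\<close>.\<close>

lemma AE_LR_pos: "AE \<omega> in P k. \<forall>i>k. 0 < LR k i \<omega>"
proof -
  have "AE \<omega> in P k. k < i \<longrightarrow> 0 < LR k i \<omega>" for i
  proof (cases "k < i")
    case True
    let ?E = "{\<omega> \<in> space Pinf. LR k i \<omega> = 0}"
    have E: "?E \<in> sets (Flt i)"
      using measurable_sets[OF LR_Flt[OF True order_refl], of "{0}"]
      by (simp add: vimage_def Int_def conj_commute)
    have "emeasure (P k) ?E = (\<integral>\<^sup>+\<omega>. ennreal (\<Prod>i\<in>{k+1..i}. LR k i \<omega>) * indicator ?E \<omega> \<partial>Pinf)"
      using True by (intro change_of_measure E) auto
    also have "\<dots> = (\<integral>\<^sup>+\<omega>. 0 \<partial>Pinf)"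
    proof (intro nn_integral_cong)
      fix \<omega>
      show "ennreal (\<Prod>j\<in>{k+1..i}. LR k j \<omega>) * indicator ?E \<omega> = 0"
      proof (cases "\<omega> \<in> ?E")
        case True
        then have "(\<Prod>j\<in>{k+1..i}. LR k j \<omega>) = 0"
          using \<open>k < i\<close> by (intro prod_zero) (auto intro!: bexI[of _ i])
        then show ?thesis by (simp only: ennreal_0 mult_zero_left)
      qed simp
    qed
    finally have "?E \<in> null_sets (P k)"
      using E sets_Flt_subset sets_P by (intro null_setsI) auto
    then have "AE \<omega> in P k. \<omega> \<notin> ?E" by (rule AE_not_in)
    then show ?thesis using AE_space
      by eventually_elim (use LR_nonneg[OF True] in \<open>auto simp: less_le\<close>)
  qed auto
  then show ?thesis by (simp add: AE_all_countable)
qed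

section \<open>Stopping times of the observation filtration\<close>

lemma sets_Flt_mono:
  assumes "m \<le> n" shows "sets (Flt m) \<subseteq> sets (Flt n)"
proof
  fix E assume "E \<in> sets (Flt m)"
  then obtain B where B: "B \<in> sets (PiM {1..m} (\<lambda>_. S))" "E = obs_vec X {1..m} -` B \<inter> space Pinf"
    unfolding sets_Flt by blast
  have "(\<lambda>\<omega>. restrict (obs_vec X {1..n} \<omega>) {1..m}) \<in> measurable (Flt n) (PiM {1..m} (\<lambda>_. S))"
    using assms by (intro measurable_compose[OF obs_vec_Flt] measurable_restrict_subset) auto
  moreover have "(\<lambda>\<omega>. restrict (obs_vec X {1..n} \<omega>) {1..m}) = obs_vec X {1..m}"
    using assms by (auto simp: obs_vec_def fun_eq_iff)
  ultimately have "obs_vec X {1..m} \<in> measurable (Flt n) (PiM {1..m} (\<lambda>_. S))" by simp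
  from measurable_sets[OF this B(1)] show "E \<in> sets (Flt n)" by (simp add: B(2))
qed

abbreviation detects :: "('a \<Rightarrow> enat) \<Rightarrow> bool" where
  "detects \<equiv> detection_procedure (space Pinf) S X"

lemma detects_le_Flt: "detects T \<Longrightarrow> {\<omega> \<in> space Pinf. T \<omega> \<le> enat n} \<in> sets (Flt n)"
  unfolding detection_procedure_def by (auto dest!: stopping_timeD[of _ _ "enat n"] simp: pred_def)

lemma detects_le_0: "detects T \<Longrightarrow> {\<omega> \<in> space Pinf. T \<omega> \<le> enat 0} = {}"
  unfolding detection_procedure_def by (force simp: zero_enat_def[symmetric])

lemma detects_eq_Flt:
  assumes "detects T"
  shows "{\<omega> \<in> space Pinf. T \<omega> = enat n} \<in> sets (Flt n)"
proof (cases n)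
  case 0
  then have "{\<omega> \<in> space Pinf. T \<omega> = enat n} = {}" using detects_le_0[OF assms] by auto
  then show ?thesis by (metis sets.empty_sets)
next
  case (Suc m)
  have "T \<omega> = enat n \<longleftrightarrow> T \<omega> \<le> enat n \<and> \<not> T \<omega> \<le> enat m" for \<omega>
    using Suc by (cases "T \<omega>") auto
  then have eq: "{\<omega> \<in> space Pinf. T \<omega> = enat n} =
      {\<omega> \<in> space Pinf. T \<omega> \<le> enat n} - {\<omega> \<in> space Pinf. T \<omega> \<le> enat m}" by auto
  have "{\<omega> \<in> space Pinf. T \<omega> \<le> enat m} \<in> sets (Flt n)"
    using sets_Flt_mono[of m n] detects_le_Flt[OF assms, of m] Suc by auto
  then show ?thesis unfolding eq using detects_le_Flt[OF assms, of n] by (rule sets.Diff[rotated])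
qed

lemma detects_le_sets: "detects T \<Longrightarrow> {\<omega> \<in> space Pinf. T \<omega> \<le> enat n} \<in> sets Pinf"
  using detects_le_Flt sets_Flt_subset by blast

lemma detects_eq_sets: "detects T \<Longrightarrow> {\<omega> \<in> space Pinf. T \<omega> = enat n} \<in> sets Pinf"
  using detects_eq_Flt sets_Flt_subset by blast

text \<open>The first \<open>k\<close> observations have the same law under \<open>P k\<close> and
  \<open>Pinf\<close>: the change of measure has an empty product. For \<open>k = 0\<close> the
  event is empty because \<open>T\<close> is at least 1.\<close>

lemma P_eq_Pinf_le:
  assumes "detects T"
  shows "measure (P k) {\<omega> \<in> space Pinf. T \<omega> \<le> enat k} = measure Pinf {\<omega> \<in> space Pinf. T \<omega> \<le> enat k}"
proof (cases "k = 0")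
  case True
  show ?thesis unfolding True detects_le_0[OF assms] by simp
next
  case False
  then show ?thesis
    using change_of_measure[of k k, OF _ _ detects_le_Flt[OF assms]] detects_le_sets[OF assms, of k]
    by (simp add: measure_def)
qed

lemma detects_le_decomp:
  assumes "detects T" and M: "finite_measure M" "sets M = sets Pinf" and "i \<le> j"
  shows "measure M {\<omega> \<in> space Pinf. T \<omega> \<le> enat j} = measure M {\<omega> \<in> space Pinf. T \<omega> \<le> enat i}
    + (\<Sum>n\<in>{i+1..j}. measure M {\<omega> \<in> space Pinf. T \<omega> = enat n})"
proof -
  interpret finite_measure M by fact
  have s: "{\<omega> \<in> space Pinf. T \<omega> = enat n} \<in> sets M" "{\<omega> \<in> space Pinf. T \<omega> \<le> enat n} \<in> sets M" for n
    using detects_eq_sets detects_le_sets assms by auto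
  have "measure M (\<Union>n\<in>{i+1..j}. {\<omega> \<in> space Pinf. T \<omega> = enat n}) =
      (\<Sum>n\<in>{i+1..j}. measure M {\<omega> \<in> space Pinf. T \<omega> = enat n})"
    by (intro finite_measure_finite_Union) (auto simp: s disjoint_family_on_def)
  moreover have "measure M ({\<omega> \<in> space Pinf. T \<omega> \<le> enat i} \<union> (\<Union>n\<in>{i+1..j}. {\<omega> \<in> space Pinf. T \<omega> = enat n}))
      = measure M {\<omega> \<in> space Pinf. T \<omega> \<le> enat i} + measure M (\<Union>n\<in>{i+1..j}. {\<omega> \<in> space Pinf. T \<omega> = enat n})"
    by (intro finite_measure_Union sets.finite_UN s) auto
  moreover have "{\<omega> \<in> space Pinf. T \<omega> \<le> enat i} \<union> (\<Union>n\<in>{i+1..j}. {\<omega> \<in> space Pinf. T \<omega> = enat n})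
      = {\<omega> \<in> space Pinf. T \<omega> \<le> enat j}" (is "?A = ?B")
  proof -
    have "\<omega> \<in> ?A \<longleftrightarrow> \<omega> \<in> ?B" for \<omega> using \<open>i \<le> j\<close> by (cases "T \<omega>") auto
    then show ?thesis by blast
  qed
  ultimately show ?thesis by simp
qed

subsection \<open>False alarm probability\<close>

lemma PFA_summable:
  "summable (\<lambda>j. prior_mass prior (Suc j) * measure Pinf {\<omega> \<in> space Pinf. T \<omega> \<le> enat (Suc j)})"
proof (rule summable_comparison_test'[where N = 0])
  show "summable (\<lambda>j. prior_mass prior (Suc j))"
    using prior_tail_sums[of prior 1] by (simp add: sums_iff)
next
  interpret prob_space Pinf by (rule prob_space_Pinf)
  show "norm (prior_mass prior (Suc j) * measure Pinf {\<omega> \<in> space Pinf. T \<omega> \<le> enat (Suc j)}) \<le> prior_mass prior (Suc j)" for j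
    by (simp add: mult_left_le)
qed

lemma PFA_nonneg: "0 \<le> PFA prior Pinf T"
  unfolding PFA_def Let_def by (intro suminf_nonneg PFA_summable) auto

text \<open>The added term with \<open>k = 0\<close> vanishes because \<open>T\<close> is at least
  1; starting at 0 aligns the series with the prior tail sums.\<close>

lemma PFA_sums:
  assumes "detects T"
  shows "(\<lambda>k. prior_mass prior k * measure Pinf {\<omega> \<in> space Pinf. T \<omega> \<le> enat k}) sums PFA prior Pinf T"
proof -
  have "(\<lambda>j. prior_mass prior (Suc j) * measure Pinf {\<omega> \<in> space Pinf. T \<omega> \<le> enat (Suc j)}) sums PFA prior Pinf T"
    unfolding PFA_def Let_def using PFA_summable by (rule summable_sums)
  from sums_Suc[OF this] show ?thesis using detects_le_0[OF assms] by simp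
qed

text \<open>The first \<open>k\<close> terms of the false alarm series are dropped, and in the
  others the probability is lowered to its value at \<open>k\<close>.\<close>

lemma tail_times_prob_le_PFA:
  assumes T: "detects T"
  shows "measure_pmf.prob prior {int k..} * measure Pinf {\<omega> \<in> space Pinf. T \<omega> \<le> enat k} \<le> PFA prior Pinf T"
proof -
  interpret prob_space Pinf by (rule prob_space_Pinf)
  let ?F = "\<lambda>k. measure Pinf {\<omega> \<in> space Pinf. T \<omega> \<le> enat k}"
  have s1: "(\<lambda>j. prior_mass prior (j + k) * ?F k) sums (measure_pmf.prob prior {int k..} * ?F k)"
    by (intro sums_mult2 prior_tail_sums)
  have s2: "(\<lambda>j. prior_mass prior (j + k) * ?F (j + k)) sums
      (PFA prior Pinf T - (\<Sum>i<k. prior_mass prior i * ?F i))"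
    by (intro sums_split_initial_segment PFA_sums T)
  have "prior_mass prior (j + k) * ?F k \<le> prior_mass prior (j + k) * ?F (j + k)" for j
  proof (intro mult_left_mono finite_measure_mono detects_le_sets T)
    show "{\<omega> \<in> space Pinf. T \<omega> \<le> enat k} \<subseteq> {\<omega> \<in> space Pinf. T \<omega> \<le> enat (j + k)}"
    proof safe
      fix \<omega> assume "T \<omega> \<le> enat k"
      also have "enat k \<le> enat (j + k)" by simp
      finally show "T \<omega> \<le> enat (j + k)" .
    qed
  qed simp
  then have "measure_pmf.prob prior {int k..} * ?F k \<le> PFA prior Pinf T - (\<Sum>i<k. prior_mass prior i * ?F i)"
    using s1 s2 by (rule sums_le)
  moreover have "0 \<le> (\<Sum>i<k. prior_mass prior i * ?F i)" by (intro sum_nonneg) auto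
  ultimately show ?thesis by linarith
qed

lemma shiryaev_stat_Flt:
  "n \<le> m \<Longrightarrow> shiryaev_stat prior LR n \<in> borel_measurable (Flt m)"
  unfolding shiryaev_stat_def[abs_def]
  by (intro borel_measurable_divide borel_measurable_add borel_measurable_times borel_measurable_const
      borel_measurable_sum borel_measurable_prod LR_Flt) auto

text \<open>A crossing up to time \<open>n\<close> is a finite union of events on statistics of the
  first \<open>n\<close> observations; at infinite time the condition is trivial.\<close>

lemma shiryaev_detects: "detects (shiryaev prior LR A)"
proof -
  have "Measurable.pred (obs_filtration (space Pinf) S X t) (\<lambda>\<omega>. shiryaev prior LR A \<omega> \<le> t)" for t
  proof (cases t)
    case (enat n)
    have "Measurable.pred (Flt n) (\<lambda>\<omega>. A \<le> shiryaev_stat prior LR j \<omega>)" if "j \<in> {1..n}" for j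
    proof -
      have [measurable]: "shiryaev_stat prior LR j \<in> borel_measurable (Flt n)"
        using shiryaev_stat_Flt that by simp
      show ?thesis by measurable
    qed
    then show ?thesis unfolding enat shiryaev_le_iff
      by (intro pred_intros_finite) auto
  qed simp
  moreover have "1 \<le> shiryaev prior LR A \<omega>" for \<omega>
    unfolding shiryaev_def by (intro INF_greatest) (auto simp: one_enat_def)
  ultimately show ?thesis unfolding detection_procedure_def stopping_time_def by blast
qed

text \<open>On the event of stopping at \<open>n\<close> the statistic is at least \<open>A\<close>.
  Multiplied by the prior tail and integrated under \<open>Pinf\<close>, each product of likelihood
  ratios turns into a probability under the corresponding \<open>P k\<close>.\<close>

lemma shiryaev_eq_prob_le:
  fixes prior A
  defines "T \<equiv> shiryaev prior LR A"
  assumes n: "1 \<le> n" and A: "0 \<le> A" and w: "0 < measure_pmf.prob prior {int n..}"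
  shows "A * measure_pmf.prob prior {int n..} * measure Pinf {\<omega> \<in> space Pinf. T \<omega> = enat n} \<le>
    prior_neg prior * measure (P 0) {\<omega> \<in> space Pinf. T \<omega> = enat n} +
    (\<Sum>k<n. prior_mass prior k * measure (P k) {\<omega> \<in> space Pinf. T \<omega> = enat n})" (is "?lhs \<le> ?rhs")
proof -
  let ?E = "{\<omega> \<in> space Pinf. T \<omega> = enat n}"
  let ?w = "measure_pmf.prob prior {int n..}"
  define R where "R = (\<lambda>k \<omega>. \<Prod>i\<in>{k+1..n}. LR k i \<omega>)"
  interpret Pinf: prob_space Pinf by (rule prob_space_Pinf)
  interpret P: prob_space "P k" for k by (rule prob_space_P)
  have E: "?E \<in> sets (Flt n)" unfolding T_def by (intro detects_eq_Flt shiryaev_detects)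
  have E'[measurable]: "?E \<in> sets Pinf" using E sets_Flt_subset by blast
  have R[measurable]: "R k \<in> borel_measurable Pinf" for k
    unfolding R_def by (intro borel_measurable_prod LR_measurable) auto
  have R_nonneg: "0 \<le> R k \<omega>" for k \<omega> unfolding R_def by (intro prod_nonneg) (auto intro: LR_nonneg)
  have q: "0 \<le> prior_neg prior" by (simp add: prior_neg_def)
  have eP: "emeasure (P k) ?E = (\<integral>\<^sup>+\<omega>. ennreal (R k \<omega>) * indicator ?E \<omega> \<partial>Pinf)" if "k \<le> n" for k
    unfolding R_def by (rule change_of_measure[OF n that E])
  have "ennreal ?lhs = (\<integral>\<^sup>+\<omega>. ennreal (A * ?w) * indicator ?E \<omega> \<partial>Pinf)"
    using A E' by (subst nn_integral_cmult_indicator) (auto simp: Pinf.emeasure_eq_measure ennreal_mult)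
  also have "\<dots> \<le> (\<integral>\<^sup>+\<omega>. ennreal (prior_neg prior) * (ennreal (R 0 \<omega>) * indicator ?E \<omega>) +
      (\<Sum>k<n. ennreal (prior_mass prior k) * (ennreal (R k \<omega>) * indicator ?E \<omega>)) \<partial>Pinf)"
  proof (rule nn_integral_mono)
    fix \<omega>
    show "ennreal (A * ?w) * indicator ?E \<omega> \<le> ennreal (prior_neg prior) * (ennreal (R 0 \<omega>) * indicator ?E \<omega>) +
      (\<Sum>k<n. ennreal (prior_mass prior k) * (ennreal (R k \<omega>) * indicator ?E \<omega>))"
    proof (cases "\<omega> \<in> ?E")
      case True
      then have "A \<le> shiryaev_stat prior LR n \<omega>" using shiryaev_eqD(2)[of prior LR A \<omega> n] by (simp add: T_def)
      then have "A * ?w \<le> prior_neg prior * R 0 \<omega> + (\<Sum>k<n. prior_mass prior k * R k \<omega>)"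
        using w unfolding shiryaev_stat_def by (simp add: pos_le_divide_eq R_def)
      then have "ennreal (A * ?w) \<le> ennreal (prior_neg prior * R 0 \<omega> + (\<Sum>k<n. prior_mass prior k * R k \<omega>))"
        by (rule ennreal_leI)
      also have "\<dots> = ennreal (prior_neg prior) * ennreal (R 0 \<omega>) + (\<Sum>k<n. ennreal (prior_mass prior k) * ennreal (R k \<omega>))"
        using q R_nonneg by (simp add: ennreal_plus ennreal_mult sum_nonneg sum_ennreal[symmetric] del: sum_ennreal)
      finally show ?thesis using True by simp
    qed simp
  qed
  also have "\<dots> = ennreal (prior_neg prior) * emeasure (P 0) ?E + (\<Sum>k<n. ennreal (prior_mass prior k) * emeasure (P k) ?E)"
    by (subst nn_integral_add) (auto simp: nn_integral_sum nn_integral_cmult eP)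
  also have "\<dots> = ennreal ?rhs"
    using q by (simp add: P.emeasure_eq_measure ennreal_plus ennreal_mult sum_nonneg sum_ennreal[symmetric] del: sum_ennreal)
  finally show ?thesis using q by (subst (asm) ennreal_le_iff) (auto intro!: add_nonneg_nonneg sum_nonneg)
qed

text \<open>With \<open>p\<close> the false alarm series cut at \<open>N\<close>, the previous bound
  summed over \<open>n\<close> gives \<open>A * p \<le> 1 - p\<close>: after a change at
  \<open>k\<close> the procedure can stop only with the probability not already spent on stopping up
  to \<open>k\<close>, and the prior weights sum to at most 1.\<close>

lemma PFA_shiryaev_le:
  assumes A: "0 \<le> A" and w: "\<And>n. 0 < measure_pmf.prob prior {int n..}"
  shows "PFA prior Pinf (shiryaev prior LR A) \<le> 1 / (1 + A)"
proof -
  define T where "T = shiryaev prior LR A"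
  have T: "detects T" unfolding T_def by (rule shiryaev_detects)
  interpret Pinf: prob_space Pinf by (rule prob_space_Pinf)
  interpret P: prob_space "P k" for k by (rule prob_space_P)
  let ?F = "\<lambda>k. measure Pinf {\<omega> \<in> space Pinf. T \<omega> \<le> enat k}"
  let ?a = "\<lambda>k n. measure (P k) {\<omega> \<in> space Pinf. T \<omega> = enat n}"
  let ?b = "\<lambda>n. measure Pinf {\<omega> \<in> space Pinf. T \<omega> = enat n}"
  let ?\<pi> = "prior_mass prior" and ?w = "\<lambda>n. measure_pmf.prob prior {int n..}"
  have q: "0 \<le> prior_neg prior" by (simp add: prior_neg_def)
  have "(\<Sum>k<N. ?\<pi> k * ?F k) \<le> 1 / (1 + A)" for N
  proof -
    let ?p = "\<Sum>k<N. ?\<pi> k * ?F k"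
    have "?p = (\<Sum>k<N. \<Sum>n\<in>{1..k}. ?\<pi> k * ?b n)"
      using detects_le_decomp[OF T Pinf.finite_measure_axioms refl, of 0] detects_le_0[OF T]
      by (simp add: sum_distrib_left)
    \<comment> \<open>Interchange of summation over pairs with \<open>n \<le> k < N\<close>; the
      term with \<open>n = N\<close> has an empty inner sum.\<close>
    also have "\<dots> = (\<Sum>n\<in>{1..N}. \<Sum>k\<in>{n..<N}. ?\<pi> k * ?b n)"
      by (simp add: sum.Sigma) (rule sum.reindex_bij_witness[of _ "\<lambda>(n,k). (k,n)" "\<lambda>(k,n). (n,k)"], auto)
    also have "\<dots> \<le> (\<Sum>n\<in>{1..N}. ?w n * ?b n)"
    proof (rule sum_mono)
      fix n
      have "(\<Sum>k\<in>{n..<N}. ?\<pi> k) = (\<Sum>j<N-n. ?\<pi> (j + n))"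
        by (rule sum.reindex_bij_witness[of _ "\<lambda>j. j + n" "\<lambda>k. k - n"]) auto
      also have "\<dots> \<le> ?w n"
        using sum_le_suminf[of "\<lambda>j. ?\<pi> (j + n)" "{..<N-n}"] prior_tail_sums[of prior n] by (simp add: sums_iff)
      finally show "(\<Sum>k\<in>{n..<N}. ?\<pi> k * ?b n) \<le> ?w n * ?b n"
        by (simp add: sum_distrib_right[symmetric] mult_right_mono)
    qed
    finally have p_le: "?p \<le> (\<Sum>n\<in>{1..N}. ?w n * ?b n)" .
    have "A * (\<Sum>n\<in>{1..N}. ?w n * ?b n) \<le> (\<Sum>n\<in>{1..N}. prior_neg prior * ?a 0 n + (\<Sum>k<n. ?\<pi> k * ?a k n))"
      unfolding sum_distrib_left
    proof (rule sum_mono)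
      fix n assume "n \<in> {1..N}"
      then show "A * (?w n * ?b n) \<le> prior_neg prior * ?a 0 n + (\<Sum>k<n. ?\<pi> k * ?a k n)"
        using shiryaev_eq_prob_le[OF _ A w, of n] by (simp add: T_def mult.assoc)
    qed
    also have "\<dots> = prior_neg prior * (\<Sum>n\<in>{1..N}. ?a 0 n) + (\<Sum>n\<in>{1..N}. \<Sum>k<n. ?\<pi> k * ?a k n)"
      by (simp add: sum.distrib sum_distrib_left)
    also have "(\<Sum>n\<in>{1..N}. \<Sum>k<n. ?\<pi> k * ?a k n) = (\<Sum>k<N. \<Sum>n\<in>{k+1..N}. ?\<pi> k * ?a k n)"
      by (simp add: sum.Sigma) (rule sum.reindex_bij_witness[of _ "\<lambda>(k,n). (n,k)" "\<lambda>(n,k). (k,n)"], auto)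
    also have "\<dots> = (\<Sum>k<N. ?\<pi> k * (\<Sum>n\<in>{k+1..N}. ?a k n))" by (simp add: sum_distrib_left)
    finally have "A * (\<Sum>n\<in>{1..N}. ?w n * ?b n) \<le>
      prior_neg prior * (\<Sum>n\<in>{1..N}. ?a 0 n) + (\<Sum>k<N. ?\<pi> k * (\<Sum>n\<in>{k+1..N}. ?a k n))" .
    \<comment> \<open>Under \<open>P k\<close>, stopping in \<open>k+1..N\<close> is disjoint from
      stopping up to \<open>k\<close>, and the latter event has its no-change probability.\<close>
    moreover have a_le: "(\<Sum>n\<in>{k+1..N}. ?a k n) \<le> 1 - ?F k" if "k \<le> N" for k
      using detects_le_decomp[OF T P.finite_measure_axioms sets_P that, of k] P_eq_Pinf_le[OF T, of k]
        P.prob_le_1[of k "{\<omega> \<in> space Pinf. T \<omega> \<le> enat N}"] by simp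
    have "prior_neg prior * (\<Sum>n\<in>{1..N}. ?a 0 n) \<le> prior_neg prior * 1"
      using q a_le[of 0] detects_le_0[OF T] by (intro mult_left_mono) auto
    moreover have "(\<Sum>k<N. ?\<pi> k * (\<Sum>n\<in>{k+1..N}. ?a k n)) \<le> (\<Sum>k<N. ?\<pi> k * (1 - ?F k))"
      by (intro sum_mono mult_left_mono a_le) auto
    moreover have "(\<Sum>k<N. ?\<pi> k * (1 - ?F k)) = (\<Sum>k<N. ?\<pi> k) - ?p"
      by (simp add: algebra_simps sum_subtractf)
    moreover have "(\<Sum>k<N. ?\<pi> k) \<le> 1 - prior_neg prior"
      using sum_le_suminf[of ?\<pi> "{..<N}"] prior_tail_sums[of prior 0] prior_total[of prior] by (simp add: sums_iff)
    moreover have "A * ?p \<le> A * (\<Sum>n\<in>{1..N}. ?w n * ?b n)" using p_le A by (rule mult_left_mono)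
    ultimately have "(1 + A) * ?p \<le> 1" by (simp add: algebra_simps)
    then show ?thesis using A by (simp add: pos_le_divide_eq mult.commute)
  qed
  moreover have "(\<lambda>N. \<Sum>k<N. ?\<pi> k * ?F k) \<longlonglongrightarrow> PFA prior Pinf T"
    using PFA_sums[OF T] by (simp add: sums_def)
  ultimately have "PFA prior Pinf T \<le> 1 / (1 + A)" by (intro LIMSEQ_le_const2) auto
  then show ?thesis by (simp add: T_def)
qed

subsection \<open>Lower bound for the delay moments\<close>

text \<open>On \<open>{T = n}\<close>, \<open>k < n\<close>, the density of \<open>P k\<close> with respect to \<open>Pinf\<close> is at most \<open>exp c\<close>
  as long as the log-likelihood ratio stays below \<open>c\<close>.\<close>

lemma prob_stop_le:
  assumes T: "detects T" and c: "0 \<le> c"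
  shows "measure (P k) {\<omega> \<in> space Pinf. T \<omega> \<le> enat (k + M)} \<le>
    exp c * measure Pinf {\<omega> \<in> space Pinf. T \<omega> \<le> enat (k + M)} +
    measure (P k) {\<omega> \<in> space Pinf. \<exists>n\<in>{1..M}. c \<le> llr LR k n \<omega>}"
proof -
  interpret Pinf: prob_space Pinf by (rule prob_space_Pinf)
  interpret Pk: prob_space "P k" by (rule prob_space_P)
  \<comment> \<open>Stopping after \<open>k\<close> is split according to whether the log-likelihood
    ratio at the stopping time is below \<open>c\<close>; the complementary case lies in
    \<open>B\<close>.\<close>
  define E where "E = (\<lambda>n. {\<omega> \<in> space Pinf. T \<omega> = enat n} \<inter> {\<omega> \<in> space Pinf. llr LR k (n - k) \<omega> < c})"
  define B where "B = {\<omega> \<in> space Pinf. \<exists>n\<in>{1..M}. c \<le> llr LR k n \<omega>}"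
  define J where "J = {k+1..k+M}"
  have E: "E n \<in> sets (Flt n)" if "n \<in> J" for n
  proof -
    have [measurable]: "llr LR k (n - k) \<in> borel_measurable (Flt n)"
      using that by (intro llr_Flt) (auto simp: J_def)
    have "{\<omega> \<in> space (Flt n). llr LR k (n - k) \<omega> < c} \<in> sets (Flt n)" by measurable
    then show ?thesis unfolding E_def using detects_eq_Flt[OF T, of n] by auto
  qed
  then have E': "E n \<in> sets Pinf" if "n \<in> J" for n using that sets_Flt_subset by blast
  have B: "B \<in> sets Pinf" unfolding B_def by measurable
  have E_le: "measure (P k) (E n) \<le> exp c * measure Pinf {\<omega> \<in> space Pinf. T \<omega> = enat n}" if n: "n \<in> J" for n
  proof -
    have "emeasure (P k) (E n) = (\<integral>\<^sup>+\<omega>. ennreal (\<Prod>i\<in>{k+1..n}. LR k i \<omega>) * indicator (E n) \<omega> \<partial>Pinf)"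
      using n by (intro change_of_measure E) (auto simp: J_def)
    also have "\<dots> \<le> (\<integral>\<^sup>+\<omega>. ennreal (exp c) * indicator {\<omega> \<in> space Pinf. T \<omega> = enat n} \<omega> \<partial>Pinf)"
    proof (rule nn_integral_mono)
      fix \<omega>
      show "ennreal (\<Prod>i\<in>{k+1..n}. LR k i \<omega>) * indicator (E n) \<omega> \<le>
        ennreal (exp c) * indicator {\<omega> \<in> space Pinf. T \<omega> = enat n} \<omega>"
      proof (cases "\<omega> \<in> E n")
        case True
        have "(\<Prod>i\<in>{k+1..n}. LR k i \<omega>) \<le> exp c"
        \<comment> \<open>A vanishing factor is treated apart: with \<open>ln 0 = 0\<close> the
          exponential of the log-likelihood ratio need not be the product, but the product itself is
          0.\<close>
        proof (cases "\<exists>i\<in>{k+1..n}. LR k i \<omega> = 0")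
          case True
          then have "(\<Prod>i\<in>{k+1..n}. LR k i \<omega>) = 0" by (intro prod_zero) auto
          then show ?thesis by (simp only: exp_ge_zero)
        next
          case False
          then have pos: "0 < LR k i \<omega>" if "i \<in> {k+1..n}" for i
            using that LR_nonneg[of k i \<omega>] by (auto simp: less_le)
          have "llr LR k (n - k) \<omega> = (\<Sum>i\<in>{k+1..n}. ln (LR k i \<omega>))"
            using n by (simp add: llr_def J_def)
          then have "exp (llr LR k (n - k) \<omega>) = (\<Prod>i\<in>{k+1..n}. LR k i \<omega>)"
            using pos by (simp add: exp_sum)
          moreover have "llr LR k (n - k) \<omega> < c" using \<open>\<omega> \<in> E n\<close> by (simp add: E_def)
          ultimately show ?thesis by (metis exp_less_cancel_iff less_imp_le)
        qed
        then show ?thesis using True by (auto simp: E_def intro: ennreal_leI)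
      qed simp
    qed
    also have "\<dots> = ennreal (exp c * measure Pinf {\<omega> \<in> space Pinf. T \<omega> = enat n})"
      using detects_eq_sets[OF T, of n]
      by (subst nn_integral_cmult_indicator) (auto simp: Pinf.emeasure_eq_measure ennreal_mult)
    finally show ?thesis by (simp add: Pk.emeasure_eq_measure)
  qed
  have sub: "{\<omega> \<in> space Pinf. T \<omega> \<le> enat (k + M)} \<subseteq> ({\<omega> \<in> space Pinf. T \<omega> \<le> enat k} \<union> (\<Union>n\<in>J. E n)) \<union> B"
  proof
    fix \<omega> assume "\<omega> \<in> {\<omega> \<in> space Pinf. T \<omega> \<le> enat (k + M)}"
    then obtain n where n: "T \<omega> = enat n" "n \<le> k + M" "\<omega> \<in> space Pinf" by (cases "T \<omega>") auto
    consider "n \<le> k" | "k < n" "llr LR k (n - k) \<omega> < c" | "k < n" "c \<le> llr LR k (n - k) \<omega>" by linarith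
    then show "\<omega> \<in> ({\<omega> \<in> space Pinf. T \<omega> \<le> enat k} \<union> (\<Union>n\<in>J. E n)) \<union> B"
    proof cases
      case 1 then show ?thesis using n by simp
    next
      case 2 then have "n \<in> J" "\<omega> \<in> E n" using n by (auto simp: J_def E_def)
      then show ?thesis by blast
    next
      case 3
      then have "n - k \<in> {1..M}" using n by auto
      then have "\<omega> \<in> B" using n 3 unfolding B_def by blast
      then show ?thesis by blast
    qed
  qed
  note m = detects_le_sets[OF T] E' B
  have finJ: "finite J" by (simp add: J_def)
  have UE: "(\<Union>n\<in>J. E n) \<in> sets (P k)" using E' finJ sets_P by (intro sets.finite_UN) auto
  have "measure (P k) {\<omega> \<in> space Pinf. T \<omega> \<le> enat (k + M)} \<le>
      measure (P k) (({\<omega> \<in> space Pinf. T \<omega> \<le> enat k} \<union> (\<Union>n\<in>J. E n)) \<union> B)"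
    using m UE sets_P by (intro Pk.finite_measure_mono sub sets.Un) auto
  also have "\<dots> \<le> measure (P k) ({\<omega> \<in> space Pinf. T \<omega> \<le> enat k} \<union> (\<Union>n\<in>J. E n)) + measure (P k) B"
    using m UE sets_P by (intro measure_Un_le sets.Un) auto
  also have "measure (P k) ({\<omega> \<in> space Pinf. T \<omega> \<le> enat k} \<union> (\<Union>n\<in>J. E n)) \<le>
      measure (P k) {\<omega> \<in> space Pinf. T \<omega> \<le> enat k} + measure (P k) (\<Union>n\<in>J. E n)"
    using m UE sets_P by (intro measure_Un_le) auto
  also have "measure (P k) (\<Union>n\<in>J. E n) \<le> (\<Sum>n\<in>J. measure (P k) (E n))"
    using finJ E' sets_P by (intro measure_UNION_le) auto
  also have "\<dots> \<le> (\<Sum>n\<in>J. exp c * measure Pinf {\<omega> \<in> space Pinf. T \<omega> = enat n})"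
    by (intro sum_mono E_le)
  \<comment> \<open>Since \<open>1 \<le> exp c\<close>, the part up to \<open>k\<close> may carry
    the same factor, and the pieces reassemble to one \<open>Pinf\<close>-probability.\<close>
  also have "measure (P k) {\<omega> \<in> space Pinf. T \<omega> \<le> enat k} \<le> exp c * measure Pinf {\<omega> \<in> space Pinf. T \<omega> \<le> enat k}"
    using c P_eq_Pinf_le[OF T, of k] mult_right_mono[of 1 "exp c" "measure Pinf {\<omega> \<in> space Pinf. T \<omega> \<le> enat k}"] by simp
  also have "exp c * measure Pinf {\<omega> \<in> space Pinf. T \<omega> \<le> enat k} + (\<Sum>n\<in>J. exp c * measure Pinf {\<omega> \<in> space Pinf. T \<omega> = enat n})
      = exp c * measure Pinf {\<omega> \<in> space Pinf. T \<omega> \<le> enat (k + M)}"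
    using detects_le_decomp[OF T Pinf.finite_measure_axioms refl, of k "k + M"]
    by (simp add: J_def sum_distrib_left distrib_left)
  finally show ?thesis by (simp add: B_def)
qed

text \<open>The bound on \<open>T\<close> enters only through its false alarm probability, so the
  threshold on \<open>\<alpha>\<close> serves the whole class at once. The factor
  \<open>exp c\<close> and the inverse prior tail together grow like a power of
  \<open>1 / \<alpha>\<close> with exponent \<open>\<kappa> < 1\<close> and are beaten by
  \<open>\<alpha>\<close>.\<close>

lemma stop_prob_vanishes:
  fixes I \<mu> b \<eta> :: real
  assumes I: "0 < I" and \<mu>: "0 \<le> \<mu>" and b: "0 < b" "b * (I + \<mu>) < 1" and \<eta>: "0 < \<eta>"
    and w: "\<And>n. 0 < measure_pmf.prob prior {int n..}"
    and tail: "(\<lambda>n. - ln (measure_pmf.prob prior {int n..}) / real n) \<longlonglongrightarrow> \<mu>"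
    and upper: "\<And>\<epsilon>. 0 < \<epsilon> \<Longrightarrow>
      (\<lambda>M. measure (P k) {\<omega> \<in> space (P k). (MAX n\<in>{1..M}. llr LR k n \<omega>) / real M \<ge> (1 + \<epsilon>) * I}) \<longlonglongrightarrow> 0"
  shows "\<forall>\<^sub>F \<alpha> in at_right 0. \<forall>T\<in>PFA_class prior S X Pinf \<alpha>.
    measure (P k) {\<omega> \<in> space Pinf. T \<omega> \<le> enat (k + nat \<lfloor>b * \<bar>ln \<alpha>\<bar>\<rfloor>)} \<le> \<eta>"
proof -
  \<comment> \<open>This choice puts \<open>(1 + \<epsilon>) * I + \<mu> + \<epsilon>\<close> at the
    midpoint between \<open>I + \<mu>\<close> and \<open>1 / b\<close>, so that
    \<open>\<kappa> < 1\<close>.\<close>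
  define \<epsilon> where "\<epsilon> = (1 / b - (I + \<mu>)) / (2 * (I + 1))"
  define \<kappa> where "\<kappa> = b * ((1 + \<epsilon>) * I + \<mu> + \<epsilon>)"
  have gap: "I + \<mu> < 1 / b" using b by (simp add: field_simps)
  then have \<epsilon>: "0 < \<epsilon>" using I by (simp add: \<epsilon>_def)
  have "(1 + \<epsilon>) * I + \<mu> + \<epsilon> = I + \<mu> + \<epsilon> * (I + 1)" by (simp add: algebra_simps)
  also have "\<epsilon> * (I + 1) = (1 / b - (I + \<mu>)) / 2"
  proof -
    have "x / (2 * y) * y = x / 2" if "0 < y" for x y :: real using that by simp
    then show ?thesis unfolding \<epsilon>_def using I by (meson add_pos_pos zero_less_one)
  qed
  also have "I + \<mu> + \<dots> < 1 / b" using gap by (simp add: field_simps)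
  finally have "b * ((1 + \<epsilon>) * I + \<mu> + \<epsilon>) < b * (1 / b)" using b(1) by (rule mult_strict_left_mono)
  then have \<kappa>: "\<kappa> < 1" using b by (simp add: \<kappa>_def)
  define M where "M = (\<lambda>\<alpha>::real. nat \<lfloor>b * \<bar>ln \<alpha>\<bar>\<rfloor>)"
  have M: "filterlim M sequentially (at_right 0)"
    unfolding M_def
    by (intro filterlim_compose[OF filterlim_nat_sequentially] filterlim_compose[OF filterlim_floor_sequentially]
        filterlim_tendsto_pos_mult_at_top[OF tendsto_const b(1)] filterlim_abs_ln_at_right_0)
  have Mk: "filterlim (\<lambda>\<alpha>. k + M \<alpha>) sequentially (at_right 0)"
    using M by (rule filterlim_at_top_mono) auto
  let ?w = "\<lambda>n. measure_pmf.prob prior {int n..}"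
  have 1: "\<forall>\<^sub>F \<alpha> in at_right 0. measure (P k) {\<omega> \<in> space (P k). (MAX n\<in>{1..M \<alpha>}. llr LR k n \<omega>) / real (M \<alpha>) \<ge> (1 + \<epsilon>) * I} < \<eta> / 2"
    using order_tendstoD(2)[OF filterlim_compose[OF upper[OF \<epsilon>] M], of "\<eta> / 2"] \<eta> by simp
  have 2: "\<forall>\<^sub>F \<alpha> in at_right 0. - ln (?w (k + M \<alpha>)) / real (k + M \<alpha>) < \<mu> + \<epsilon>"
    using order_tendstoD(2)[OF filterlim_compose[OF tail Mk], of "\<mu> + \<epsilon>"] \<epsilon> by simp
  \<comment> \<open>Small \<open>\<alpha>\<close> lets the surplus
    \<open>(1 - \<kappa>) * \<bar>ln \<alpha>\<bar>\<close> absorb the fixed cost of the first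
    \<open>k\<close> observations and bring the bound below \<open>\<eta> / 2\<close>.\<close>
  have 3: "\<forall>\<^sub>F \<alpha> in at_right 0. ((\<mu> + \<epsilon>) * real k - ln (\<eta> / 2)) / (1 - \<kappa>) \<le> \<bar>ln \<alpha>\<bar>"
    using filterlim_abs_ln_at_right_0 unfolding filterlim_at_top by blast
  have 4: "\<forall>\<^sub>F \<alpha> in at_right 0. 1 \<le> M \<alpha>"
    using M unfolding filterlim_at_top by blast
  have 5: "\<forall>\<^sub>F \<alpha> in at_right (0::real). \<alpha> \<in> {0<..<1}"
    by (rule eventually_at_right_real) simp
  show ?thesis using 1 2 3 4 5
  proof eventually_elim
    case (elim \<alpha>)
    let ?M = "M \<alpha>" and ?c = "(1 + \<epsilon>) * I * real (M \<alpha>)"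
    have M_le: "real ?M \<le> b * \<bar>ln \<alpha>\<bar>" using b by (simp add: M_def)
    have M_eq: "nat \<lfloor>b * \<bar>ln \<alpha>\<bar>\<rfloor> = ?M" by (simp add: M_def)
    show ?case unfolding M_eq
    proof
      fix T assume "T \<in> PFA_class prior S X Pinf \<alpha>"
      then have T: "detects T" and PFA: "PFA prior Pinf T \<le> \<alpha>" by (auto simp: PFA_class_def)
      let ?F = "measure Pinf {\<omega> \<in> space Pinf. T \<omega> \<le> enat (k + ?M)}"
      have "exp c * ?F \<le> exp (c + ln \<alpha> + (\<mu> + \<epsilon>) * real (k + ?M))" for c
      proof -
        have "- ln (?w (k + ?M)) \<le> (\<mu> + \<epsilon>) * real (k + ?M)"
        proof -
          have "0 < real (k + ?M)" using elim(4) by simp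
          with elim(2) show ?thesis by (simp only: pos_divide_less_eq less_imp_le)
        qed
        then have "exp (- ((\<mu> + \<epsilon>) * real (k + ?M))) \<le> ?w (k + ?M)"
          using w[of "k + ?M"] by (metis exp_le_cancel_iff exp_ln minus_le_iff)
        then have "exp (- ((\<mu> + \<epsilon>) * real (k + ?M))) * ?F \<le> ?w (k + ?M) * ?F" by (rule mult_right_mono) simp
        also have "\<dots> \<le> \<alpha>" using tail_times_prob_le_PFA[OF T] PFA by (rule order_trans)
        finally have F: "exp (- ((\<mu> + \<epsilon>) * real (k + ?M))) * ?F \<le> \<alpha>" .
        have "x \<le> \<alpha> * exp z" if "exp (- z) * x \<le> \<alpha>" for x z :: real
          using that by (simp add: exp_minus inverse_eq_divide pos_divide_le_eq)
        from this[OF F] have "?F \<le> \<alpha> * exp ((\<mu> + \<epsilon>) * real (k + ?M))" .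
        then show ?thesis using elim(5) by (simp add: exp_add mult_left_mono)
      qed
      then have "exp ?c * ?F \<le> exp (?c + ln \<alpha> + (\<mu> + \<epsilon>) * real (k + ?M))" .
      also have "?c + ln \<alpha> + (\<mu> + \<epsilon>) * real (k + ?M) \<le> ln (\<eta> / 2)"
      proof -
        have "?c + (\<mu> + \<epsilon>) * real ?M = ((1 + \<epsilon>) * I + \<mu> + \<epsilon>) * real ?M" by (simp add: algebra_simps)
        also have "\<dots> \<le> ((1 + \<epsilon>) * I + \<mu> + \<epsilon>) * (b * \<bar>ln \<alpha>\<bar>)"
          using M_le \<epsilon> I \<mu> by (intro mult_left_mono) auto
        also have "\<dots> = \<kappa> * \<bar>ln \<alpha>\<bar>" by (simp add: \<kappa>_def)
        finally have *: "?c + (\<mu> + \<epsilon>) * real ?M \<le> \<kappa> * \<bar>ln \<alpha>\<bar>" .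
        have "ln \<alpha> = - \<bar>ln \<alpha>\<bar>" using elim(5) by simp
        moreover have "(\<mu> + \<epsilon>) * real k - ln (\<eta> / 2) \<le> \<bar>ln \<alpha>\<bar> * (1 - \<kappa>)"
          using elim(3) \<kappa> by (simp add: pos_divide_le_eq)
        ultimately show ?thesis using * by (simp add: algebra_simps)
      qed
      finally have "exp ?c * ?F \<le> \<eta> / 2" using \<eta> by simp
      \<comment> \<open>The maximum is taken over a nonempty set and can be rescaled because
        \<open>M \<alpha>\<close> is at least 1.\<close>
      moreover have max_eq: "{\<omega> \<in> space Pinf. \<exists>n\<in>{1..?M}. ?c \<le> llr LR k n \<omega>} =
          {\<omega> \<in> space (P k). (MAX n\<in>{1..?M}. llr LR k n \<omega>) / real ?M \<ge> (1 + \<epsilon>) * I}"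
        using elim(4) by (auto simp: pos_le_divide_eq Max_ge_iff)
      moreover have "0 \<le> ?c" using \<epsilon> I by simp
      ultimately show "measure (P k) {\<omega> \<in> space Pinf. T \<omega> \<le> enat (k + ?M)} \<le> \<eta>"
        using prob_stop_le[OF T, of ?c k ?M] elim(1) unfolding max_eq by linarith
    qed
  qed
qed

text \<open>Markov's inequality is applied for finitely many change points \<open>k < K\<close> that
  carry almost all the prior mass on the nonnegative integers; the remaining terms and the
  denominator are dropped.\<close>

lemma delay_moment_lower_bound:
  fixes I \<mu> m c :: real
  assumes I: "0 < I" and \<mu>: "0 \<le> \<mu>" and m: "0 < m"
    and w: "\<And>n. 0 < measure_pmf.prob prior {int n..}"
    and tail: "(\<lambda>n. - ln (measure_pmf.prob prior {int n..}) / real n) \<longlonglongrightarrow> \<mu>"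
    and upper: "\<And>\<epsilon> k. 0 < \<epsilon> \<Longrightarrow>
      (\<lambda>M. measure (P k) {\<omega> \<in> space (P k). (MAX n\<in>{1..M}. llr LR k n \<omega>) / real M \<ge> (1 + \<epsilon>) * I}) \<longlonglongrightarrow> 0"
    and c: "0 < c" "c < (1 - prior_neg prior) * (1 / (I + \<mu>)) powr m"
  shows "\<forall>\<^sub>F \<alpha> in at_right 0. \<forall>T\<in>PFA_class prior S X Pinf \<alpha>.
    ennreal (c * \<bar>ln \<alpha>\<bar> powr m) \<le> delay_moment prior Pinf P m T"
proof -
  let ?q = "1 - prior_neg prior" and ?\<pi> = "prior_mass prior"
  define c0 where "c0 = ?q * (1 / (I + \<mu>)) powr m"
  have c0: "0 < c0" "c < c0" using c by (auto simp: c0_def)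
  \<comment> \<open>The slack \<open>c / c0\<close> is the cube of \<open>t\<close> because one
    factor \<open>t\<close> is lost in each of three places: the truncation of the prior at
    \<open>K\<close>, the choice of \<open>b\<close>, and the probability of not having
    stopped.\<close>
  define t where "t = (c / c0) powr (1/3)"
  have t: "0 < t" "t < 1"
    using c c0 powr_less_mono2[of "1/3" "c / c0" 1] by (auto simp: t_def)
  have "t powr 3 = c / c0" unfolding t_def powr_powr using c c0 by simp
  then have t3: "t * t * t = c / c0" using t by (simp add: powr_numeral power3_eq_cube)
  define b where "b = t powr (1/m) / (I + \<mu>)"
  have b: "0 < b" "b powr m = t * (1 / (I + \<mu>)) powr m"
    using t I \<mu> m by (auto simp: b_def powr_divide powr_powr)
  have "t powr (1/m) < 1" using t m powr_less_mono2[of "1/m" t 1] by simp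
  then have b1: "b * (I + \<mu>) < 1" using I \<mu> by (simp add: b_def)
  have q: "0 < ?q" using w[of 0] prior_total[of prior] by simp
  have "(\<lambda>K. \<Sum>k<K. ?\<pi> k) \<longlonglongrightarrow> ?q"
    using prior_tail_sums[of prior 0] prior_total[of prior] by (simp add: sums_def)
  then have "\<forall>\<^sub>F K in sequentially. t * ?q < (\<Sum>k<K. ?\<pi> k)"
    by (rule order_tendstoD(1)) (use t q in simp)
  then obtain K where K: "t * ?q < (\<Sum>k<K. ?\<pi> k)" by (meson eventually_happens trivial_limit_sequentially)
  have "\<forall>\<^sub>F \<alpha> in at_right 0. \<forall>k\<in>{..<K}. \<forall>T\<in>PFA_class prior S X Pinf \<alpha>.
    measure (P k) {\<omega> \<in> space Pinf. T \<omega> \<le> enat (k + nat \<lfloor>b * \<bar>ln \<alpha>\<bar>\<rfloor>)} \<le> 1 - t"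
    using t by (intro eventually_ball_finite ballI stop_prob_vanishes[OF I \<mu> b(1) b1 _ w tail upper]) auto
  then show ?thesis
  proof eventually_elim
    case (elim \<alpha>)
    show ?case
    proof
      fix T assume "T \<in> PFA_class prior S X Pinf \<alpha>"
      then have T: "detects T" and le: "\<And>k. k < K \<Longrightarrow>
          measure (P k) {\<omega> \<in> space Pinf. T \<omega> \<le> enat (k + nat \<lfloor>b * \<bar>ln \<alpha>\<bar>\<rfloor>)} \<le> 1 - t"
        using elim by (auto simp: PFA_class_def)
      define y where "y = b * \<bar>ln \<alpha>\<bar>"
      have y: "0 \<le> y" using b by (simp add: y_def)
      let ?e = "\<lambda>k. \<integral>\<^sup>+\<omega>. enat_powr (T \<omega> - enat k) m \<partial>(P k)"
      have Ek: "ennreal (y powr m * t) \<le> ?e k" if k: "k < K" for k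
      proof -
        interpret Pk: prob_space "P k" by (rule prob_space_P)
        let ?G = "{\<omega> \<in> space Pinf. T \<omega> \<le> enat (k + nat \<lfloor>y\<rfloor>)}"
        have G: "?G \<in> sets (P k)" using detects_le_sets[OF T] sets_P by simp
        have "t \<le> measure (P k) (space (P k) - ?G)"
          using Pk.prob_compl[OF G] le[OF k] by (simp add: y_def)
        then have "ennreal (y powr m * t) \<le> ennreal (y powr m) * emeasure (P k) (space (P k) - ?G)"
          by (simp add: Pk.emeasure_eq_measure ennreal_mult[symmetric] ennreal_leI mult_left_mono)
        also have "\<dots> = (\<integral>\<^sup>+\<omega>. ennreal (y powr m) * indicator (space (P k) - ?G) \<omega> \<partial>(P k))"
          using sets.compl_sets[OF G] by (subst nn_integral_cmult_indicator) auto
        also have "\<dots> \<le> ?e k"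
        proof (rule nn_integral_mono)
          fix \<omega>
          show "ennreal (y powr m) * indicator (space (P k) - ?G) \<omega> \<le> enat_powr (T \<omega> - enat k) m"
          proof (cases "\<omega> \<in> space (P k) - ?G")
            case True
            then have gt: "enat (k + nat \<lfloor>y\<rfloor>) < T \<omega>" by auto
            have "ennreal (y powr m) \<le> enat_powr (T \<omega> - enat k) m"
            proof (cases "T \<omega>")
              case (enat j)
              \<comment> \<open>An integer above \<open>k + nat \<lfloor>y\<rfloor>\<close> exceeds
                \<open>k\<close> by at least the floor of \<open>y\<close> plus 1, hence by more
                than \<open>y\<close>.\<close>
              then have "k + nat \<lfloor>y\<rfloor> < j" using gt by simp
              then have "y \<le> real (j - k)" by linarith
              then show ?thesis using enat y m by (auto simp: enat_powr_def intro!: ennreal_leI powr_mono2)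
            qed (simp add: enat_powr_def)
            then show ?thesis using True by simp
          qed simp
        qed
        finally show ?thesis .
      qed
      have "c * \<bar>ln \<alpha>\<bar> powr m = (t * ?q) * (t * t * (1 / (I + \<mu>)) powr m * \<bar>ln \<alpha>\<bar> powr m)"
      proof -
        have "c = t * t * t * c0" using t3 c0 by simp
        then show ?thesis by (simp add: c0_def)
      qed
      also have "t * t * (1 / (I + \<mu>)) powr m * \<bar>ln \<alpha>\<bar> powr m = y powr m * t"
        by (simp add: y_def powr_mult b(2))
      also have "(t * ?q) * (y powr m * t) \<le> (\<Sum>k<K. ?\<pi> k) * (y powr m * t)"
        using K t by (intro mult_right_mono) auto
      finally have "ennreal (c * \<bar>ln \<alpha>\<bar> powr m) \<le> ennreal ((\<Sum>k<K. ?\<pi> k) * (y powr m * t))"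
        by (rule ennreal_leI)
      also have "\<dots> = (\<Sum>k<K. ennreal (?\<pi> k) * ennreal (y powr m * t))"
        using t by (simp add: sum_distrib_right ennreal_mult[symmetric])
      also have "\<dots> \<le> (\<Sum>k<K. ennreal (?\<pi> k) * ?e k)"
        by (intro sum_mono mult_left_mono Ek) auto
      also have "\<dots> \<le> (\<Sum>k. ennreal (?\<pi> k) * ?e k)" by (intro sum_le_suminf) auto
      also have "\<dots> \<le> delay_moment prior Pinf P m T"
        unfolding delay_moment_def using PFA_nonneg[of prior T]
        by (intro le_ennreal_divide) (simp add: ennreal_le_1)
      finally show "ennreal (c * \<bar>ln \<alpha>\<bar> powr m) \<le> delay_moment prior Pinf P m T" .
    qed
  qed
qed

subsection \<open>Upper bound for the Shiryaev procedure\<close>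

text \<open>All summands of the statistic are nonnegative, so the \<open>k\<close>-th alone is below
  the threshold. Enlarging the tail at \<open>k + n\<close> to the tail at \<open>n\<close> leaves a
  bound that depends on \<open>k\<close> only through its prior mass.\<close>

lemma llr_less_of_not_stopped:
  fixes prior A
  assumes pos: "\<forall>i>k. 0 < LR k i \<omega>" and \<pi>: "0 < prior_mass prior k" and n: "1 \<le> n"
    and w: "\<And>n. 0 < measure_pmf.prob prior {int n..}" and A: "0 < A"
    and run: "enat (k + n) < shiryaev prior LR A \<omega>"
  shows "llr LR k n \<omega> < ln A - ln (prior_mass prior k) + ln (measure_pmf.prob prior {int n..})"
proof -
  let ?\<pi> = "prior_mass prior" and ?w = "\<lambda>n. measure_pmf.prob prior {int n..}"
  let ?R = "\<lambda>j. \<Prod>i\<in>{j+1..k+n}. LR j i \<omega>"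
  have R: "0 \<le> ?R j" for j by (intro prod_nonneg) (auto intro: LR_nonneg)
  have "\<not> A \<le> shiryaev_stat prior LR (k + n) \<omega>"
    using run n shiryaev_le_iff[of prior LR A \<omega> "k + n"] by auto
  then have "prior_neg prior * ?R 0 + (\<Sum>j<k+n. ?\<pi> j * ?R j) < A * ?w (k + n)"
    using w[of "k + n"] unfolding shiryaev_stat_def by (simp add: not_le pos_divide_less_eq)
  moreover have "?\<pi> k * exp (llr LR k n \<omega>) \<le> (\<Sum>j<k+n. ?\<pi> j * ?R j)"
  proof -
    have "?R k = exp (llr LR k n \<omega>)" using pos by (simp add: llr_def exp_sum)
    moreover have "?\<pi> k * ?R k \<le> (\<Sum>j<k+n. ?\<pi> j * ?R j)"
      by (rule member_le_sum[where f = "\<lambda>j. ?\<pi> j * ?R j"])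
        (use n R in \<open>auto intro: mult_nonneg_nonneg simp del: One_nat_def add_Suc_right\<close>)
    ultimately show ?thesis by simp
  qed
  moreover have "0 \<le> prior_neg prior * ?R 0" using R[of 0] by (simp add: prior_neg_def)
  moreover have "A * ?w (k + n) \<le> A * ?w n" using A by (intro mult_left_mono prior_tail_antimono) auto
  ultimately have "?\<pi> k * exp (llr LR k n \<omega>) < A * ?w n" by linarith
  then have "ln (?\<pi> k * exp (llr LR k n \<omega>)) < ln (A * ?w n)"
    using \<pi> A w[of n] by (intro ln_less_cancel_iff[THEN iffD2]) auto
  then show ?thesis using \<pi> A w[of n] by (simp add: ln_mult)
qed

text \<open>Continuing for \<open>n\<close> steps beyond the change, with \<open>n\<close> past a
  fixed time, forces the event that \<open>Upsilon\<close> weighs. The telescoped tail series then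
  integrates to a deterministic power plus a multiple of \<open>Upsilon\<close>.\<close>

lemma shiryaev_moment_le:
  fixes prior and A m r c I \<mu> \<epsilon> :: real and N0 :: nat
  assumes \<pi>: "0 < prior_mass prior k"
    and w: "\<And>n. 0 < measure_pmf.prob prior {int n..}" and A: "1 \<le> A"
    and m: "0 < m" and c: "0 \<le> c" "\<And>n. 1 \<le> n \<Longrightarrow> real (Suc n) powr m \<le> real n powr m + c * real n powr (r - 1)"
    and \<epsilon>: "2 * \<epsilon> < I + \<mu>" and N0: "1 \<le> N0" "\<And>n. N0 \<le> n \<Longrightarrow> (\<mu> - \<epsilon>) * real n \<le> - ln (measure_pmf.prob prior {int n..})"
  shows "(\<integral>\<^sup>+\<omega>. enat_powr (shiryaev prior LR A \<omega> - enat k) m \<partial>(P k)) \<le>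
    ennreal ((ln A / (I + \<mu> - 2 * \<epsilon>) + (real N0 + 1 + 1 / (I + \<mu> - 2 * \<epsilon>) * \<bar>ln (prior_mass prior k)\<bar>)) powr m)
    + ennreal c * Upsilon P LR I k r \<epsilon>"
proof -
  let ?T = "shiryaev prior LR A" and ?D = "I + \<mu> - 2 * \<epsilon>"
  interpret Pk: prob_space "P k" by (rule prob_space_P)
  \<comment> \<open>From this time on, the rate \<open>I - \<epsilon>\<close> of the log-likelihood
    ratio plus the rate \<open>\<mu> - \<epsilon>\<close> of the prior tail outweigh the threshold
    and the prior mass.\<close>
  define \<rho> where "\<rho> = (ln A + \<bar>ln (prior_mass prior k)\<bar>) / ?D"
  have D: "0 < ?D" using \<epsilon> by simp
  have \<rho>: "0 \<le> \<rho>" using A D by (simp add: \<rho>_def)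
  define N where "N = max N0 (nat \<lceil>\<rho>\<rceil>)"
  have N: "1 \<le> N" "N0 \<le> N" "\<rho> \<le> real N" "real N \<le> real N0 + 1 + \<rho>"
    using N0(1) \<rho> by (auto simp: N_def max_def) linarith+
  define B where "B = (\<lambda>j. {\<omega> \<in> space (P k). llr LR k (Suc j) \<omega> / real (Suc j) < I - \<epsilon>})"
  define a where "a = (\<lambda>j. ennreal (c * real (Suc j) powr (r - 1)))"
  have B[measurable]: "B j \<in> sets (P k)" for j unfolding B_def by measurable
  have "AE \<omega> in P k. enat_powr (?T \<omega> - enat k) m \<le>
      ennreal (real N powr m) + (\<Sum>j. a j * indicator (B j) \<omega>)"
    using AE_LR_pos[of k] AE_space
  proof eventually_elim
    case (elim \<omega>)
    have "enat_powr (?T \<omega> - enat k) m \<le> ennreal (real N powr m) +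
        (\<Sum>j. if N \<le> Suc j \<and> enat (Suc j) < ?T \<omega> - enat k then a j else 0)"
      unfolding a_def by (rule enat_powr_le_tail_series[OF m N(1) c])
    also have "\<dots> \<le> ennreal (real N powr m) + (\<Sum>j. a j * indicator (B j) \<omega>)"
    proof (intro add_left_mono suminf_le allI)
      fix j
      have "\<omega> \<in> B j" if "N \<le> Suc j" "enat (Suc j) < ?T \<omega> - enat k"
      proof -
        have "enat (k + Suc j) < ?T \<omega>" using that(2) by (cases "?T \<omega>") auto
        then have "llr LR k (Suc j) \<omega> < ln A - ln (prior_mass prior k) + ln (measure_pmf.prob prior {int (Suc j)..})"
          using elim \<pi> w A by (intro llr_less_of_not_stopped) auto
        moreover have "(\<mu> - \<epsilon>) * real (Suc j) \<le> - ln (measure_pmf.prob prior {int (Suc j)..})"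
          using that N by (intro N0(2)) linarith
        moreover have "\<rho> \<le> real (Suc j)" using that N by linarith
        then have "ln A + \<bar>ln (prior_mass prior k)\<bar> \<le> real (Suc j) * ?D"
          using D unfolding \<rho>_def by (simp only: pos_divide_le_eq)
        moreover have "real (Suc j) * ?D = (I - \<epsilon>) * real (Suc j) + (\<mu> - \<epsilon>) * real (Suc j)"
          by (simp add: algebra_simps)
        ultimately have "llr LR k (Suc j) \<omega> < (I - \<epsilon>) * real (Suc j)" by linarith
        then show ?thesis using elim by (simp add: B_def pos_divide_less_eq)
      qed
      then show "(if N \<le> Suc j \<and> enat (Suc j) < ?T \<omega> - enat k then a j else 0)
          \<le> a j * indicator (B j) \<omega>"
        by (cases "N \<le> Suc j \<and> enat (Suc j) < ?T \<omega> - enat k") auto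
    qed auto
    finally show ?case .
  qed
  then have "(\<integral>\<^sup>+\<omega>. enat_powr (?T \<omega> - enat k) m \<partial>(P k)) \<le>
      (\<integral>\<^sup>+\<omega>. ennreal (real N powr m) + (\<Sum>j. a j * indicator (B j) \<omega>) \<partial>(P k))"
    by (rule nn_integral_mono_AE)
  also have "\<dots> = ennreal (real N powr m) + (\<Sum>j. a j * emeasure (P k) (B j))"
    using B by (subst nn_integral_add) (auto simp: nn_integral_suminf nn_integral_cmult_indicator Pk.emeasure_space_1[simplified])
  also have "(\<Sum>j. a j * emeasure (P k) (B j)) = ennreal c * Upsilon P LR I k r \<epsilon>"
  proof -
    have "a j * emeasure (P k) (B j) = ennreal c * ennreal (real (Suc j) powr (r - 1) * measure (P k) (B j))" for j
      using c by (simp add: a_def Pk.emeasure_eq_measure ennreal_mult mult.assoc)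
    then show ?thesis unfolding Upsilon_def Let_def B_def by (simp only: ennreal_suminf_cmult)
  qed
  also have "real N powr m \<le> (ln A / ?D + (real N0 + 1 + 1 / ?D * \<bar>ln (prior_mass prior k)\<bar>)) powr m"
    using N m by (intro powr_mono2) (auto simp: \<rho>_def add_divide_distrib)
  finally show ?thesis by (simp add: ennreal_leI add_right_mono)
qed

text \<open>Summing the bounds for single change points against the prior gives a leading term in
  \<open>ln A powr m\<close> plus a remainder that does not depend on \<open>A\<close>; both the
  remainder and the denominator are negligible for large \<open>A\<close>.\<close>

lemma delay_moment_shiryaev_le:
  fixes prior and I \<mu> m r d :: real
  assumes I: "0 < I" and \<mu>: "0 \<le> \<mu>" and m: "0 < m" "m \<le> r"
    and w: "\<And>n. 0 < measure_pmf.prob prior {int n..}"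
    and tail: "(\<lambda>n. - ln (measure_pmf.prob prior {int n..}) / real n) \<longlonglongrightarrow> \<mu>"
    and log: "summable (\<lambda>k. prior_mass prior k * \<bar>ln (prior_mass prior k)\<bar> powr r)"
    and lower: "\<And>\<epsilon>. 0 < \<epsilon> \<Longrightarrow> (\<Sum>k. ennreal (prior_mass prior k) * Upsilon P LR I k r \<epsilon>) < \<infinity>"
    and d: "(1 - prior_neg prior) * (1 / (I + \<mu>)) powr m < d"
  shows "\<forall>\<^sub>F A in at_top. delay_moment prior Pinf P m (shiryaev prior LR A) \<le> ennreal (d * ln A powr m)"
proof -
  let ?q = "1 - prior_neg prior" and ?\<pi> = "prior_mass prior" and ?w = "\<lambda>n. measure_pmf.prob prior {int n..}"
  have q: "0 < ?q" using w[of 0] prior_total[of prior] by simp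
  \<comment> \<open>One parameter \<open>s\<close> is both the slack in the rates and the
    \<open>\<eta>\<close> of \<open>powr_add_le\<close>. The leading constant is continuous at
    \<open>s = 0\<close>, so a small \<open>s\<close> keeps it below \<open>d\<close>.\<close>
  have "((\<lambda>s. ?q * ((1 + s) powr m * (1 / (I + \<mu> - 2 * s)) powr m)) \<longlongrightarrow>
      ?q * ((1 + 0) powr m * (1 / (I + \<mu> - 2 * 0)) powr m)) (at_right 0)"
    using I \<mu> by (intro tendsto_intros) auto
  then have "\<forall>\<^sub>F s in at_right 0. ?q * ((1 + s) powr m * (1 / (I + \<mu> - 2 * s)) powr m) < d"
    by (rule order_tendstoD(2)) (use d in simp)
  moreover have "\<forall>\<^sub>F s in at_right 0. s \<in> {0<..<(I + \<mu>) / 2}"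
    using I \<mu> by (intro eventually_at_right_real) auto
  ultimately have "\<forall>\<^sub>F s in at_right 0. ?q * ((1 + s) powr m * (1 / (I + \<mu> - 2 * s)) powr m) < d \<and> s \<in> {0<..<(I + \<mu>) / 2}"
    by (rule eventually_conj)
  then obtain s where s: "?q * ((1 + s) powr m * (1 / (I + \<mu> - 2 * s)) powr m) < d" "0 < s" "2 * s < I + \<mu>"
    using eventually_happens'[OF trivial_limit_at_right_real] by fastforce
  let ?D = "I + \<mu> - 2 * s"
  define d1 where "d1 = ?q * ((1 + s) powr m * (1 / ?D) powr m)"
  have d1: "0 < d1" "d1 < d" using s q by (auto simp: d1_def)
  have "\<forall>\<^sub>F n in sequentially. \<mu> - s < - ln (?w n) / real n"
    using tail by (rule order_tendstoD(1)) (use s in simp)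
  then obtain N1 where N1: "\<And>n. N1 \<le> n \<Longrightarrow> \<mu> - s < - ln (?w n) / real n"
    unfolding eventually_sequentially by blast
  define N0 where "N0 = max 1 N1"
  have N0: "1 \<le> N0" "\<And>n. N0 \<le> n \<Longrightarrow> (\<mu> - s) * real n \<le> - ln (?w n)"
  proof -
    fix n assume "N0 \<le> n"
    then have "\<mu> - s < - ln (?w n) / real n" "0 < real n" using N1[of n] by (auto simp: N0_def)
    then show "(\<mu> - s) * real n \<le> - ln (?w n)" by (simp only: pos_less_divide_eq less_imp_le)
  qed (simp add: N0_def)
  obtain c where c: "0 \<le> c" "\<And>n. 1 \<le> n \<Longrightarrow> real (Suc n) powr m \<le> real n powr m + c * real n powr (r - 1)"
    using powr_Suc_increment[OF m] by blast
  let ?b = "\<lambda>k. real N0 + 1 + 1 / ?D * \<bar>ln (?\<pi> k)\<bar>"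
  have sumb: "summable (\<lambda>k. ?\<pi> k * ?b k powr m)"
    using s by (intro summable_prior_affine_moment[OF log m]) auto
  \<comment> \<open>\<open>K1\<close> collects the prior part of the waiting times and
    \<open>K2\<close> the \<open>Upsilon\<close> sum; both are finite and free of
    \<open>A\<close>.\<close>
  define K1 where "K1 = (1 + 1 / s) powr m * (\<Sum>k. ?\<pi> k * ?b k powr m)"
  have K1: "0 \<le> K1" unfolding K1_def by (intro mult_nonneg_nonneg suminf_nonneg sumb) auto
  let ?U = "\<Sum>k. ennreal (?\<pi> k) * Upsilon P LR I k r s"
  define K2 where "K2 = enn2real ?U"
  have U: "?U = ennreal K2" using lower[OF s(2)] by (simp add: K2_def)
  have K2: "0 \<le> K2" by (simp add: K2_def)
  define K where "K = K1 + c * K2"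
  have numer: "(\<Sum>k. ennreal (?\<pi> k) * (\<integral>\<^sup>+\<omega>. enat_powr (shiryaev prior LR A \<omega> - enat k) m \<partial>(P k)))
      \<le> ennreal (d1 * ln A powr m + K)" if A: "1 \<le> A" for A
  proof -
    let ?a = "(1 + s) powr m * ((1 / ?D) powr m * ln A powr m)" and ?s' = "(1 + 1 / s) powr m"
    have lnA: "0 \<le> ln A" using A by simp
    have "ennreal (?\<pi> k) * (\<integral>\<^sup>+\<omega>. enat_powr (shiryaev prior LR A \<omega> - enat k) m \<partial>(P k)) \<le>
        ennreal (?\<pi> k * ?a + ?s' * (?\<pi> k * ?b k powr m)) + ennreal c * (ennreal (?\<pi> k) * Upsilon P LR I k r s)" for k
    proof (cases "?\<pi> k = 0")
      case False
      then have \<pi>: "0 < ?\<pi> k" using prior_mass_nonneg[of prior k] by linarith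
      have "(ln A / ?D + ?b k) powr m \<le> (1 + s) powr m * (ln A / ?D) powr m + ?s' * ?b k powr m"
        using s lnA m by (intro powr_add_le) auto
      also have "(ln A / ?D) powr m = (1 / ?D) powr m * ln A powr m"
        using s lnA by (simp add: powr_divide)
      finally have "?\<pi> k * (ln A / ?D + ?b k) powr m \<le> ?\<pi> k * (?a + ?s' * ?b k powr m)"
        by (rule mult_left_mono) simp
      then have *: "?\<pi> k * (ln A / ?D + ?b k) powr m \<le> ?\<pi> k * ?a + ?s' * (?\<pi> k * ?b k powr m)"
        by (simp add: algebra_simps)
      have "ennreal (?\<pi> k) * (\<integral>\<^sup>+\<omega>. enat_powr (shiryaev prior LR A \<omega> - enat k) m \<partial>(P k)) \<le>
          ennreal (?\<pi> k) * (ennreal ((ln A / ?D + ?b k) powr m) + ennreal c * Upsilon P LR I k r s)"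
        by (intro mult_left_mono shiryaev_moment_le[OF \<pi> w A m(1) c s(3) N0]) auto
      also have "\<dots> = ennreal (?\<pi> k * (ln A / ?D + ?b k) powr m) + ennreal c * (ennreal (?\<pi> k) * Upsilon P LR I k r s)"
        by (simp add: distrib_left ennreal_mult mult.left_commute)
      also have "\<dots> \<le> ennreal (?\<pi> k * ?a + ?s' * (?\<pi> k * ?b k powr m)) + ennreal c * (ennreal (?\<pi> k) * Upsilon P LR I k r s)"
        by (intro add_right_mono ennreal_leI *)
      finally show ?thesis .
    qed simp
    then have "(\<Sum>k. ennreal (?\<pi> k) * (\<integral>\<^sup>+\<omega>. enat_powr (shiryaev prior LR A \<omega> - enat k) m \<partial>(P k))) \<le>
        (\<Sum>k. ennreal (?\<pi> k * ?a + ?s' * (?\<pi> k * ?b k powr m)) + ennreal c * (ennreal (?\<pi> k) * Upsilon P LR I k r s))"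
      by (intro suminf_le) auto
    also have "\<dots> = (\<Sum>k. ennreal (?\<pi> k * ?a + ?s' * (?\<pi> k * ?b k powr m))) + ennreal c * ?U"
      by (subst suminf_add[symmetric]) auto
    also have "(\<lambda>k. ?\<pi> k * ?a + ?s' * (?\<pi> k * ?b k powr m)) sums (?q * ?a + K1)"
      unfolding K1_def using prior_tail_sums[of prior 0] prior_total[of prior] sumb
      by (intro sums_add sums_mult2 sums_mult summable_sums) auto
    then have "(\<Sum>k. ennreal (?\<pi> k * ?a + ?s' * (?\<pi> k * ?b k powr m))) = ennreal (?q * ?a + K1)"
      by (intro suminf_ennreal_eq) (auto intro!: add_nonneg_nonneg mult_nonneg_nonneg)
    also have "ennreal (?q * ?a + K1) + ennreal c * ?U = ennreal (d1 * ln A powr m + K)"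
      using K1 K2 c(1) q unfolding U d1_def K_def
      by (simp add: ennreal_mult[symmetric] ennreal_plus[symmetric] mult.assoc add.assoc del: ennreal_plus)
    finally show ?thesis .
  qed
  \<comment> \<open>The gap from \<open>d1\<close> to \<open>d2\<close> absorbs the constant
    \<open>K\<close>, and the gap from \<open>d2\<close> to \<open>d\<close> absorbs the denominator
    \<open>1 - PFA\<close>.\<close>
  define d2 where "d2 = (d1 + d) / 2"
  have d2: "d1 < d2" "d2 < d" "0 < d2" using d1 by (auto simp: d2_def)
  have "filterlim (\<lambda>A. ln A powr m) at_top at_top"
    by (rule filterlim_compose[OF filterlim_powr_at_top[OF m(1)] ln_at_top])
  then have "\<forall>\<^sub>F A in at_top. K / (d2 - d1) \<le> ln A powr m" unfolding filterlim_at_top by blast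
  \<comment> \<open>This lower bound on \<open>A\<close> amounts to
    \<open>d2 \<le> d * (A / (1 + A))\<close>.\<close>
  moreover have "\<forall>\<^sub>F A in at_top. max 1 (1 / (d / d2 - 1)) \<le> A" by (rule eventually_ge_at_top)
  ultimately show ?thesis
  proof eventually_elim
    case (elim A)
    then have A: "1 \<le> A" by simp
    let ?L = "ln A powr m" and ?T = "shiryaev prior LR A"
    have "K \<le> ?L * (d2 - d1)" using elim(1) d2 by (simp add: pos_divide_le_eq)
    then have K: "d1 * ?L + K \<le> d2 * ?L" by (simp add: algebra_simps)
    have "1 / (1 + A) = 1 - A / (1 + A)" using A by (simp add: field_simps)
    then have PFA: "A / (1 + A) \<le> 1 - PFA prior Pinf ?T" using PFA_shiryaev_le[OF _ w, of A] A by simp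
    have "0 < d / d2 - 1" using d2 by simp
    then have "1 \<le> (d / d2 - 1) * A" using elim(2) by (simp add: pos_divide_le_eq mult.commute)
    then have "d2 * (1 + A) \<le> d * A" using d2 by (simp add: field_simps)
    then have "d2 \<le> d * (A / (1 + A))" using A by (simp add: pos_le_divide_eq)
    then have "d2 * ?L \<le> d * (A / (1 + A)) * ?L" by (rule mult_right_mono) simp
    also have "\<dots> \<le> d * ?L * (1 - PFA prior Pinf ?T)"
      using mult_left_mono[OF PFA, of "d * ?L"] d1 by (simp add: mult_ac)
    finally have le: "d1 * ?L + K \<le> (1 - PFA prior Pinf ?T) * (d * ?L)" using K by (simp add: mult.commute)
    have pos: "0 < 1 - PFA prior Pinf ?T"
    proof -
      have "0 < A / (1 + A)" using A by simp
      then show ?thesis using PFA by linarith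
    qed
    show ?case unfolding delay_moment_def
    proof (rule divide_le_posI_ennreal)
      show "0 < ennreal (1 - PFA prior Pinf ?T)" using pos by simp
      have "(\<Sum>k. ennreal (?\<pi> k) * (\<integral>\<^sup>+\<omega>. enat_powr (?T \<omega> - enat k) m \<partial>(P k))) \<le> ennreal (d1 * ?L + K)"
        by (rule numer[OF A])
      also have "\<dots> \<le> ennreal ((1 - PFA prior Pinf ?T) * (d * ?L))" using le by (rule ennreal_leI)
      also have "\<dots> = ennreal (1 - PFA prior Pinf ?T) * ennreal (d * ?L)" using pos by (intro ennreal_mult') simp
      finally show "(\<Sum>k. ennreal (?\<pi> k) * (\<integral>\<^sup>+\<omega>. enat_powr (?T \<omega> - enat k) m \<partial>(P k))) \<le>
        ennreal (1 - PFA prior Pinf ?T) * ennreal (d * ?L)" .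
    qed
  qed
qed

end

section \<open>First-order asymptotics\<close>

text \<open>Positivity of all prior tails is explicit because, with \<open>ln 0 = 0\<close>, a prior
  bounded above would satisfy the tail limit with \<open>\<mu> = 0\<close>. The disjunction on
  \<open>A\<close> treats the explicit threshold and a general admissible choice together.\<close>

theorem theorem3p1:
  fixes S :: "'b measure"
    and X :: "nat \<Rightarrow> 'a \<Rightarrow> 'b"
    and Pinf :: "'a measure"
    and P :: "nat \<Rightarrow> 'a measure"
    and pinf :: "nat \<Rightarrow> (nat \<Rightarrow> 'b) \<Rightarrow> 'b \<Rightarrow> real"
    and p0 :: "nat \<Rightarrow> nat \<Rightarrow> (nat \<Rightarrow> 'b) \<Rightarrow> 'b \<Rightarrow> real"
    and L :: "nat \<Rightarrow> nat \<Rightarrow> 'a \<Rightarrow> real"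
    and prior :: "int pmf"
    and q r \<mu> I :: real
  assumes model: "changepoint_model S X Pinf P pinf p0"
    and L: "L = lik_ratio pinf p0 X"
    and q: "q = prior_neg prior" "q < 1"
    and r: "1 \<le> r"
    and \<mu>: "0 \<le> \<mu>"
    and tail_pos: "\<And>n. prior_cdf prior n < 1"
    and tail: "(\<lambda>n. \<bar>ln (1 - prior_cdf prior n)\<bar> / real n) \<longlonglongrightarrow> \<mu>"
    and heavy: "\<mu> = 0 \<Longrightarrow> summable (\<lambda>k. prior_mass prior k * \<bar>ln (prior_mass prior k)\<bar> powr r)"
    and I: "0 < I"
    and upper: "\<And>\<epsilon> k. 0 < \<epsilon> \<Longrightarrow>
      (\<lambda>M. measure (P k) {\<omega> \<in> space (P k).
          (MAX n\<in>{1..M}. llr L k n \<omega>) / real M \<ge> (1 + \<epsilon>) * I}) \<longlonglongrightarrow> 0"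
    and lower: "\<And>\<epsilon>. 0 < \<epsilon> \<Longrightarrow>
      (\<Sum>k. ennreal (prior_mass prior k) * Upsilon P L I k r \<epsilon>) < \<infinity>"
  shows
    "(\<forall>m. 0 < m \<and> m \<le> r \<longrightarrow>
       ((\<lambda>A. delay_moment prior Pinf P m (shiryaev prior L A) / ennreal (ln A powr m))
          \<longlongrightarrow> ennreal ((1 - q) * (1 / (I + \<mu>) powr m))) at_top)
     \<and>
     (\<forall>\<alpha>. 0 < \<alpha> \<and> \<alpha> < 1 - q \<longrightarrow>
       shiryaev prior L ((1 - \<alpha>) / \<alpha>) \<in> PFA_class prior S X Pinf \<alpha>)
     \<and>
     (\<forall>A. (\<forall>\<alpha>. A \<alpha> = (1 - \<alpha>) / \<alpha>) \<or>
          ((\<forall>\<^sub>F \<alpha> in at_right 0. q / (1 - q) < A \<alpha> \<and>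
              PFA prior Pinf (shiryaev prior L (A \<alpha>)) \<le> \<alpha>) \<and>
           ((\<lambda>\<alpha>. ln (A \<alpha>) / \<bar>ln \<alpha>\<bar>) \<longlongrightarrow> 1) (at_right 0)) \<longrightarrow>
       (\<forall>\<^sub>F \<alpha> in at_right 0. shiryaev prior L (A \<alpha>) \<in> PFA_class prior S X Pinf \<alpha>) \<and>
       (\<forall>m. 0 < m \<and> m \<le> r \<longrightarrow>
         ((\<lambda>\<alpha>. (INF T\<in>PFA_class prior S X Pinf \<alpha>. delay_moment prior Pinf P m T)
                / delay_moment prior Pinf P m (shiryaev prior L (A \<alpha>))) \<longlongrightarrow> 1) (at_right 0) \<and>
         ratio_equiv (\<lambda>\<alpha>. INF T\<in>PFA_class prior S X Pinf \<alpha>. delay_moment prior Pinf P m T)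
           (at_right 0) (\<lambda>\<alpha>. delay_moment prior Pinf P m (shiryaev prior L (A \<alpha>))) \<and>
         ratio_equiv (\<lambda>\<alpha>. delay_moment prior Pinf P m (shiryaev prior L (A \<alpha>)))
           (at_right 0) (\<lambda>\<alpha>. ennreal ((1 - q) * (\<bar>ln \<alpha>\<bar> / (I + \<mu>)) powr m)) \<and>
         ratio_equiv (\<lambda>\<alpha>. INF T\<in>PFA_class prior S X Pinf \<alpha>. delay_moment prior Pinf P m T)
           (at_right 0) (\<lambda>\<alpha>. ennreal ((1 - q) * (\<bar>ln \<alpha>\<bar> / (I + \<mu>)) powr m))))"
proof -
  interpret changepoint_model S X Pinf P pinf p0 by (rule model)
  let ?w = "\<lambda>n. measure_pmf.prob prior {int n..}" and ?T = "\<lambda>A. shiryaev prior L A"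
  let ?D = "delay_moment prior Pinf P" and ?C = "PFA_class prior S X Pinf"
  have w: "0 < ?w n" for n by (rule prior_tail_pos[OF tail_pos])
  have tail': "(\<lambda>n. - ln (?w n) / real n) \<longlonglongrightarrow> \<mu>" by (rule prior_tail_exponent[OF tail_pos tail])
  have log: "summable (\<lambda>k. prior_mass prior k * \<bar>ln (prior_mass prior k)\<bar> powr r)"
    using summable_prior_log_moment[OF tail_pos tail] heavy \<mu> r by (cases "\<mu> = 0") auto
  have T: "detects (?T A)" for A unfolding L by (rule shiryaev_detects)
  have PFA: "PFA prior Pinf (?T A) \<le> 1 / (1 + A)" if "0 \<le> A" for A
    unfolding L using that w by (rule PFA_shiryaev_le)
  have Lower: "\<forall>\<^sub>F \<alpha> in at_right 0. \<forall>T\<in>?C \<alpha>. ennreal (c * \<bar>ln \<alpha>\<bar> powr m) \<le> ?D m T"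
    if "0 < m" "0 < c" "c < (1 - q) * (1 / (I + \<mu>)) powr m" for c m
    using delay_moment_lower_bound[OF I \<mu> that(1) w tail' upper[unfolded L]] that(2,3)
    unfolding q by blast
  have Upper: "\<forall>\<^sub>F A in at_top. ?D m (?T A) \<le> ennreal (d * ln A powr m)"
    if "0 < m" "m \<le> r" "(1 - q) * (1 / (I + \<mu>)) powr m < d" for d m
    using delay_moment_shiryaev_le[OF I \<mu> that(1,2) w tail' log lower[unfolded L]] that(3)
    unfolding q L by blast
  have c0: "0 < (1 - q) * (1 / (I + \<mu>)) powr m" for m using q(2) I \<mu> by simp

  have moment: "((\<lambda>A. ?D m (?T A) / ennreal (ln A powr m)) \<longlongrightarrow> ennreal ((1 - q) * (1 / (I + \<mu>)) powr m)) at_top"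
    if m: "0 < m" "m \<le> r" for m
  proof (rule tendsto_ennreal_ratio[OF c0])
    show "\<forall>\<^sub>F A in at_top. 0 < ln A powr m"
      using eventually_gt_at_top[of 1] by eventually_elim simp
    show "\<forall>\<^sub>F A in at_top. ?D m (?T A) \<le> ennreal (d * ln A powr m)" if "(1 - q) * (1 / (I + \<mu>)) powr m < d" for d
      by (rule Upper[OF m that])
    fix c assume c: "0 < c" "c < (1 - q) * (1 / (I + \<mu>)) powr m"
    \<comment> \<open>The lower bound over classes is used with
      \<open>\<alpha> = 1 / (1 + A)\<close>: the procedure belongs to that class by the false alarm
      bound, and \<open>ln A \<le> \<bar>ln \<alpha>\<bar>\<close>.\<close>
    have "filterlim (\<lambda>A::real. 1 / (1 + A)) (at_right 0) at_top"
      unfolding filterlim_at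
    proof
      show "((\<lambda>A::real. 1 / (1 + A)) \<longlongrightarrow> 0) at_top"
        by (intro tendsto_divide_0[OF tendsto_const] filterlim_at_top_imp_at_infinity
            filterlim_tendsto_add_at_top[OF tendsto_const] filterlim_ident)
      show "\<forall>\<^sub>F A::real in at_top. 1 / (1 + A) \<in> {0<..} \<and> 1 / (1 + A) \<noteq> 0"
        using eventually_gt_at_top[of 0] by eventually_elim auto
    qed
    from eventually_compose_filterlim[OF Lower[OF m(1) c] this] eventually_gt_at_top[of 1]
    show "\<forall>\<^sub>F A in at_top. ennreal (c * ln A powr m) \<le> ?D m (?T A)"
    proof eventually_elim
      case (elim A)
      have "ln A \<le> ln (1 + A)" using elim by simp
      also have "\<dots> = \<bar>ln (1 / (1 + A))\<bar>" using elim by (simp add: ln_div)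
      finally have "c * ln A powr m \<le> c * \<bar>ln (1 / (1 + A))\<bar> powr m"
        using c elim m by (intro mult_left_mono powr_mono2) auto
      then have "ennreal (c * ln A powr m) \<le> ennreal (c * \<bar>ln (1 / (1 + A))\<bar> powr m)" by (rule ennreal_leI)
      also have "\<dots> \<le> ?D m (?T A)"
        using elim T PFA[of A] by (simp add: PFA_class_def)
      finally show ?case .
    qed
  qed

  have in_class: "?T ((1 - \<alpha>) / \<alpha>) \<in> ?C \<alpha>" if "0 < \<alpha>" "\<alpha> < 1 - q" for \<alpha>
  proof -
    have "0 \<le> q" by (simp add: q prior_neg_def)
    then have "0 \<le> (1 - \<alpha>) / \<alpha>" using that by simp
    moreover have "1 / (1 + (1 - \<alpha>) / \<alpha>) = \<alpha>" using that by (simp add: field_simps)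
    ultimately show ?thesis using T PFA[of "(1 - \<alpha>) / \<alpha>"] by (simp add: PFA_class_def)
  qed

  have optimal: "(\<forall>\<^sub>F \<alpha> in at_right 0. ?T (A \<alpha>) \<in> ?C \<alpha>) \<and>
       (\<forall>m. 0 < m \<and> m \<le> r \<longrightarrow>
         ((\<lambda>\<alpha>. (INF T\<in>?C \<alpha>. ?D m T) / ?D m (?T (A \<alpha>))) \<longlongrightarrow> 1) (at_right 0) \<and>
         ratio_equiv (\<lambda>\<alpha>. INF T\<in>?C \<alpha>. ?D m T) (at_right 0) (\<lambda>\<alpha>. ?D m (?T (A \<alpha>))) \<and>
         ratio_equiv (\<lambda>\<alpha>. ?D m (?T (A \<alpha>))) (at_right 0)
           (\<lambda>\<alpha>. ennreal ((1 - q) * (\<bar>ln \<alpha>\<bar> / (I + \<mu>)) powr m)) \<and>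
         ratio_equiv (\<lambda>\<alpha>. INF T\<in>?C \<alpha>. ?D m T) (at_right 0)
           (\<lambda>\<alpha>. ennreal ((1 - q) * (\<bar>ln \<alpha>\<bar> / (I + \<mu>)) powr m)))"
    if A: "(\<forall>\<alpha>. A \<alpha> = (1 - \<alpha>) / \<alpha>) \<or>
          ((\<forall>\<^sub>F \<alpha> in at_right 0. q / (1 - q) < A \<alpha> \<and> PFA prior Pinf (?T (A \<alpha>)) \<le> \<alpha>) \<and>
           ((\<lambda>\<alpha>. ln (A \<alpha>) / \<bar>ln \<alpha>\<bar>) \<longlongrightarrow> 1) (at_right 0))" for A :: "real \<Rightarrow> real"
  proof -
    \<comment> \<open>Both choices of the threshold are reduced to these three properties, which are
      all that the remaining argument uses of \<open>A\<close>.\<close>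
    have cls: "\<forall>\<^sub>F \<alpha> in at_right 0. ?T (A \<alpha>) \<in> ?C \<alpha>" and ratio: "((\<lambda>\<alpha>. ln (A \<alpha>) / \<bar>ln \<alpha>\<bar>) \<longlongrightarrow> 1) (at_right 0)"
      and A_pos: "\<forall>\<^sub>F \<alpha> in at_right 0. 0 < A \<alpha>"
    proof -
      have small: "\<forall>\<^sub>F \<alpha> in at_right (0::real). \<alpha> \<in> {0<..<1 - q}"
        using q by (intro eventually_at_right_real) simp
      have q0: "0 \<le> q" by (simp add: q prior_neg_def)
      have "(\<forall>\<^sub>F \<alpha> in at_right 0. ?T (A \<alpha>) \<in> ?C \<alpha>) \<and> ((\<lambda>\<alpha>. ln (A \<alpha>) / \<bar>ln \<alpha>\<bar>) \<longlongrightarrow> 1) (at_right 0)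
        \<and> (\<forall>\<^sub>F \<alpha> in at_right 0. 0 < A \<alpha>)"
        using A
      proof
        assume A: "\<forall>\<alpha>. A \<alpha> = (1 - \<alpha>) / \<alpha>"
        have "\<forall>\<^sub>F \<alpha> in at_right 0. ?T (A \<alpha>) \<in> ?C \<alpha>"
          using small by eventually_elim (use in_class A in auto)
        moreover have "\<forall>\<^sub>F \<alpha> in at_right 0. 0 < A \<alpha>"
          using small by eventually_elim (use A q0 in auto)
        moreover have "((\<lambda>\<alpha>. ln ((1 - \<alpha>) / \<alpha>) / \<bar>ln \<alpha>\<bar>) \<longlongrightarrow> 1) (at_right (0::real))"
          by real_asymp
        ultimately show ?thesis using A by simp
      next
        assume A: "(\<forall>\<^sub>F \<alpha> in at_right 0. q / (1 - q) < A \<alpha> \<and> PFA prior Pinf (?T (A \<alpha>)) \<le> \<alpha>) \<and>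
           ((\<lambda>\<alpha>. ln (A \<alpha>) / \<bar>ln \<alpha>\<bar>) \<longlongrightarrow> 1) (at_right 0)"
        have "0 \<le> q / (1 - q)" using q0 q(2) by simp
        then have "\<forall>\<^sub>F \<alpha> in at_right 0. 0 < A \<alpha>"
          using A by (auto elim!: eventually_mono)
        moreover have "\<forall>\<^sub>F \<alpha> in at_right 0. ?T (A \<alpha>) \<in> ?C \<alpha>"
          using A T by (auto simp: PFA_class_def elim!: eventually_mono)
        ultimately show ?thesis using A by simp
      qed
      then show "\<forall>\<^sub>F \<alpha> in at_right 0. ?T (A \<alpha>) \<in> ?C \<alpha>" "((\<lambda>\<alpha>. ln (A \<alpha>) / \<bar>ln \<alpha>\<bar>) \<longlongrightarrow> 1) (at_right 0)"
        "\<forall>\<^sub>F \<alpha> in at_right 0. 0 < A \<alpha>" by auto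
    qed
    have small: "\<forall>\<^sub>F \<alpha> in at_right (0::real). \<alpha> \<in> {0<..<1}" by (rule eventually_at_right_real) simp
    have lnA: "filterlim (\<lambda>\<alpha>. ln (A \<alpha>)) at_top (at_right 0)"
    proof -
      have "filterlim (\<lambda>\<alpha>. ln (A \<alpha>) / \<bar>ln \<alpha>\<bar> * \<bar>ln \<alpha>\<bar>) at_top (at_right 0)"
        by (rule filterlim_tendsto_pos_mult_at_top[OF ratio _ filterlim_abs_ln_at_right_0]) simp
      moreover have "\<forall>\<^sub>F \<alpha> in at_right 0. ln (A \<alpha>) / \<bar>ln \<alpha>\<bar> * \<bar>ln \<alpha>\<bar> = ln (A \<alpha>)"
        using small by eventually_elim auto
      ultimately show ?thesis by (subst (asm) filterlim_cong[OF refl refl]) auto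
    qed
    have A_top: "filterlim A at_top (at_right 0)"
    proof -
      have "filterlim (\<lambda>\<alpha>. exp (ln (A \<alpha>))) at_top (at_right 0)"
        by (rule filterlim_compose[OF exp_at_top lnA])
      \<comment> \<open>Recovering \<open>A\<close> from its logarithm relies on positivity; in the
        general case it comes from the lower bound \<open>q / (1 - q)\<close>.\<close>
      moreover have "\<forall>\<^sub>F \<alpha> in at_right 0. exp (ln (A \<alpha>)) = A \<alpha>"
        using A_pos by eventually_elim simp
      ultimately show ?thesis by (subst (asm) filterlim_cong[OF refl refl]) auto
    qed
    have "((\<lambda>\<alpha>. (INF T\<in>?C \<alpha>. ?D m T) / ?D m (?T (A \<alpha>))) \<longlongrightarrow> 1) (at_right 0) \<and>
         ratio_equiv (\<lambda>\<alpha>. INF T\<in>?C \<alpha>. ?D m T) (at_right 0) (\<lambda>\<alpha>. ?D m (?T (A \<alpha>))) \<and>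
         ratio_equiv (\<lambda>\<alpha>. ?D m (?T (A \<alpha>))) (at_right 0)
           (\<lambda>\<alpha>. ennreal ((1 - q) * (\<bar>ln \<alpha>\<bar> / (I + \<mu>)) powr m)) \<and>
         ratio_equiv (\<lambda>\<alpha>. INF T\<in>?C \<alpha>. ?D m T) (at_right 0)
           (\<lambda>\<alpha>. ennreal ((1 - q) * (\<bar>ln \<alpha>\<bar> / (I + \<mu>)) powr m))"
      if m: "0 < m" "m \<le> r" for m
    proof -
      let ?c0 = "(1 - q) * (1 / (I + \<mu>)) powr m" and ?h = "\<lambda>\<alpha>::real. \<bar>ln \<alpha>\<bar> powr m"
      have h: "\<forall>\<^sub>F \<alpha> in at_right 0. 0 < ?h \<alpha>"
        using small by eventually_elim auto
      have upA: "\<forall>\<^sub>F \<alpha> in at_right 0. ?D m (?T (A \<alpha>)) \<le> ennreal (d * ?h \<alpha>)" if d: "?c0 < d" for d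
      proof -
        \<comment> \<open>The room between \<open>d'\<close> and \<open>d\<close> pays for replacing
          \<open>ln (A \<alpha>)\<close> by \<open>\<bar>ln \<alpha>\<bar>\<close>.\<close>
        obtain d' where d': "?c0 < d'" "d' < d" using dense[OF d] by blast
        have "((\<lambda>\<alpha>. d' * (ln (A \<alpha>) / \<bar>ln \<alpha>\<bar>) powr m) \<longlongrightarrow> d' * 1 powr m) (at_right 0)"
          by (intro tendsto_mult tendsto_const tendsto_powr ratio) auto
        then have "\<forall>\<^sub>F \<alpha> in at_right 0. d' * (ln (A \<alpha>) / \<bar>ln \<alpha>\<bar>) powr m < d"
          by (rule order_tendstoD(2)) (use d' in simp)
        moreover have "\<forall>\<^sub>F \<alpha> in at_right 0. 0 < ln (A \<alpha>)"
          using lnA unfolding filterlim_at_top_dense by blast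
        moreover have "\<forall>\<^sub>F \<alpha> in at_right 0. ?D m (?T (A \<alpha>)) \<le> ennreal (d' * ln (A \<alpha>) powr m)"
          by (rule eventually_compose_filterlim[OF Upper[OF m d'(1)] A_top])
        ultimately show ?thesis using h
        proof eventually_elim
          case (elim \<alpha>)
          have "d' * ln (A \<alpha>) powr m = d' * (ln (A \<alpha>) / \<bar>ln \<alpha>\<bar>) powr m * ?h \<alpha>"
            using elim by (simp add: powr_divide)
          also have "\<dots> \<le> d * ?h \<alpha>" using elim by (intro mult_right_mono) auto
          finally show ?case using elim(3) by (meson ennreal_leI order_trans)
        qed
      qed
      have INF_le: "\<forall>\<^sub>F \<alpha> in at_right 0. (INF T\<in>?C \<alpha>. ?D m T) \<le> ?D m (?T (A \<alpha>))"
        using cls by eventually_elim (rule INF_lower)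
      have limA: "((\<lambda>\<alpha>. ?D m (?T (A \<alpha>)) / ennreal (?h \<alpha>)) \<longlongrightarrow> ennreal ?c0) (at_right 0)"
      proof (rule tendsto_ennreal_ratio[OF c0 h _ upA])
        fix c assume "0 < c" "c < ?c0"
        from Lower[OF m(1) this] cls show "\<forall>\<^sub>F \<alpha> in at_right 0. ennreal (c * ?h \<alpha>) \<le> ?D m (?T (A \<alpha>))"
          by eventually_elim blast
      qed
      \<comment> \<open>The infimum inherits its upper bound from the Shiryaev procedure, a member
        of the class, and its lower bound from the uniformity over the class.\<close>
      have limI: "((\<lambda>\<alpha>. (INF T\<in>?C \<alpha>. ?D m T) / ennreal (?h \<alpha>)) \<longlongrightarrow> ennreal ?c0) (at_right 0)"
      proof (rule tendsto_ennreal_ratio[OF c0 h])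
        fix c assume "0 < c" "c < ?c0"
        from Lower[OF m(1) this] show "\<forall>\<^sub>F \<alpha> in at_right 0. ennreal (c * ?h \<alpha>) \<le> (INF T\<in>?C \<alpha>. ?D m T)"
          by eventually_elim (auto intro: INF_greatest)
      next
        fix d assume "?c0 < d"
        from upA[OF this] INF_le show "\<forall>\<^sub>F \<alpha> in at_right 0. (INF T\<in>?C \<alpha>. ?D m T) \<le> ennreal (d * ?h \<alpha>)"
          by eventually_elim (rule order_trans)
      qed
      \<comment> \<open>The explicit approximation is an exact multiple of \<open>?h\<close>, so it
        joins the other two functions with the same limit and all equivalences follow from one
        lemma.\<close>
      have limG: "((\<lambda>\<alpha>. ennreal ((1 - q) * (\<bar>ln \<alpha>\<bar> / (I + \<mu>)) powr m) / ennreal (?h \<alpha>)) \<longlongrightarrow> ennreal ?c0) (at_right 0)"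
      proof (rule tendsto_eventually)
        show "\<forall>\<^sub>F \<alpha> in at_right 0. ennreal ((1 - q) * (\<bar>ln \<alpha>\<bar> / (I + \<mu>)) powr m) / ennreal (?h \<alpha>) = ennreal ?c0"
          using h
        proof eventually_elim
          case (elim \<alpha>)
          have eq: "(1 - q) * (\<bar>ln \<alpha>\<bar> / (I + \<mu>)) powr m = ?c0 * ?h \<alpha>"
            using I \<mu> by (simp add: powr_divide)
          have "ennreal (?c0 * ?h \<alpha>) / ennreal (?h \<alpha>) = ennreal (?c0 * ?h \<alpha> / ?h \<alpha>)"
            by (rule divide_ennreal[OF mult_nonneg_nonneg[OF less_imp_le[OF c0] powr_ge_zero] elim])
          also have "?c0 * ?h \<alpha> / ?h \<alpha> = ?c0"
            by (rule nonzero_mult_div_cancel_right) (use elim in linarith)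
          finally show ?case by (simp only: eq)
        qed
      qed
      let ?J = "\<lambda>\<alpha>. INF T\<in>?C \<alpha>. ?D m T" and ?E = "\<lambda>\<alpha>. ?D m (?T (A \<alpha>))"
        and ?G = "\<lambda>\<alpha>. ennreal ((1 - q) * (\<bar>ln \<alpha>\<bar> / (I + \<mu>)) powr m)"
      have 1: "ratio_equiv ?J (at_right 0) ?E"
        by (rule ratio_equiv_of_common_limit[OF c0 h limI limA])
      have 2: "ratio_equiv ?E (at_right 0) ?G"
        by (rule ratio_equiv_of_common_limit[OF c0 h limA limG])
      have 3: "ratio_equiv ?J (at_right 0) ?G"
        by (rule ratio_equiv_of_common_limit[OF c0 h limI limG])
      have 4: "((\<lambda>\<alpha>. ?J \<alpha> / ?E \<alpha>) \<longlongrightarrow> 1) (at_right 0)"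
        using 1 unfolding ratio_equiv_def .
      show ?thesis by (rule conjI[OF 4 conjI[OF 1 conjI[OF 2 3]]])
    qed
    then show ?thesis using cls by blast
  qed
  show ?thesis
  proof (intro conjI[OF _ conjI] allI)
    fix m
    \<comment> \<open>The statement has the power in the denominator, the internal limit has a power
      of the reciprocal; the two constants agree.\<close>
    show "0 < m \<and> m \<le> r \<longrightarrow>
       ((\<lambda>A. ?D m (?T A) / ennreal (ln A powr m)) \<longlongrightarrow> ennreal ((1 - q) * (1 / (I + \<mu>) powr m))) at_top"
      using moment[of m] I \<mu> by (auto simp: powr_divide)
  next
    fix \<alpha>
    show "0 < \<alpha> \<and> \<alpha> < 1 - q \<longrightarrow> ?T ((1 - \<alpha>) / \<alpha>) \<in> ?C \<alpha>" using in_class[of \<alpha>] by blast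
  qed (rule impI, erule optimal)
qed

end
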